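(* Consider a sequence of instances with $N\to\infty$, where each instance is either the uniform space $\Omega$ of perfect matchings of $K_N$ ($N$ even) or of $K_{N,N}$, together with a regular collection $\mathcal{M}$ of nonempty matchings of the underlying graph; let $A_M=\{F\in\Omega:M\subseteq F\}$, $r=\max_{M\in\mathcal{M}}|M|$ and $\mu=\sum_{M\in\mathcal{M}}\Pr(A_M)$. Suppose $\mu=o(\sqrt N\,r^{-3/2})$, $\mu$ is bounded below by a fixed positive constant, and $\mathcal{M}$ is $\delta$-sparse for some $\delta=\delta(N)$ with $\delta=o(\mu^{-1})$. Then \[\Pr\Big(\bigwedge_{M\in\mathcal{M}}\overline{A_M}\Big)=(1+o(1))e^{-\mu}.\]
   Context: $\mathcal{M}$ is regular if for every $i$ there is an integer $d_i$ such that every vertex of the underlying graph lies in exactly $d_i$ matchings of $\mathcal{M}_i=\{M\in\mathcal{M}:|M|=i\}$. Let $I=\{i:\mathcal{M}_i\ne\emptyset\}$. In the $K_N$ case $p_{s,i}=\frac{1}{(s-1)(s-3)\cdots(s-2i+1)}$; in the $K_{N,N}$ case $p_{s,i}=\frac{1}{s(s-1)\cdots(s-i+1)}$. Two matchings are in conflict if their union (multiple edges suppressed) is not a matching. For $F\in\mathcal{M}$, $\mathcal{M}_F=\{M\setminus F: M\in\mathcal{M}, M\ne F, M\cap F\ne\emptyset, F\text{ not in conflict with }M\}$. $\mathcal{M}$ is $\delta$-sparse if: (1) no matching of $\mathcal{M}$ is a subset of another; (2) $\sum_{j\in I}d_jp_{N-2r+2,j}<\frac{1}{8r}-\delta$;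 (3) for every $F\in\mathcal{M}$, $\sum_{M\in\mathcal{M}_F}p_{N,|M|}\le\delta$; (4) $16r\delta<1$. *)

theory Defs
  imports "HOL-Probability.Probability" "HOL-Library.Landau_Symbols"
begin

text \<open>\<^verbatim>\<open>Complete\<close> stands for \<open>K_N\<close> and \<^verbatim>\<open>Bipartite\<close> for \<open>K_{N,N}\<close>,
  whose colour classes are \<open>{..<N}\<close> and \<open>{N..<2*N}\<close>. An edge is the set of its two end vertices.\<close>

datatype host = Complete | Bipartite

fun verts :: "host \<Rightarrow> nat \<Rightarrow> nat set" where
  "verts Complete N = {..<N}"
| "verts Bipartite N = {..<2 * N}"

fun edges :: "host \<Rightarrow> nat \<Rightarrow> nat set set" where
  "edges Complete N = {{u, v} | u v. u < N \<and> v < N \<and> u \<noteq> v}"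
| "edges Bipartite N = {{u, v} | u v. u < N \<and> N \<le> v \<and> v < 2 * N}"

definition matching :: "host \<Rightarrow> nat \<Rightarrow> nat set set \<Rightarrow> bool" where
  "matching h N M \<longleftrightarrow> M \<subseteq> edges h N \<and> pairwise disjnt M"

definition perfect_matchings :: "host \<Rightarrow> nat \<Rightarrow> nat set set set" where
  "perfect_matchings h N = {F. matching h N F \<and> \<Union>F = verts h N}"

definition prob_pm :: "host \<Rightarrow> nat \<Rightarrow> nat set set set \<Rightarrow> real" where
  "prob_pm h N A = measure_pmf.prob (pmf_of_set (perfect_matchings h N)) A"

definition ext_event :: "host \<Rightarrow> nat \<Rightarrow> nat set set \<Rightarrow> nat set set set" where
  "ext_event h N M = {F \<in> perfect_matchings h N. M \<subseteq> F}"

definition max_size :: "nat set set set \<Rightarrow> nat" where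
  "max_size MM = Max (card ` MM)"

definition mu :: "host \<Rightarrow> nat \<Rightarrow> nat set set set \<Rightarrow> real" where
  "mu h N MM = (\<Sum>M\<in>MM. prob_pm h N (ext_event h N M))"

definition of_size :: "nat set set set \<Rightarrow> nat \<Rightarrow> nat set set set" where
  "of_size MM i = {M \<in> MM. card M = i}"

definition regular_collection ::
    "host \<Rightarrow> nat \<Rightarrow> nat set set set \<Rightarrow> (nat \<Rightarrow> nat) \<Rightarrow> bool" where
  "regular_collection h N MM d \<longleftrightarrow>
     (\<forall>i. \<forall>v\<in>verts h N. card {M \<in> of_size MM i. v \<in> \<Union>M} = d i)"

text \<open>The parameter \<open>s\<close> is real because \<open>N - 2r + 2\<close> can be negative for \<open>K_{N,N}\<close>.\<close>

fun pr_ext :: "host \<Rightarrow> real \<Rightarrow> nat \<Rightarrow> real" where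
  "pr_ext Complete s i = 1 / (\<Prod>k<i. s - (2 * real k + 1))"
| "pr_ext Bipartite s i = 1 / (\<Prod>k<i. s - real k)"

definition conflict :: "host \<Rightarrow> nat \<Rightarrow> nat set set \<Rightarrow> nat set set \<Rightarrow> bool" where
  "conflict h N M M' \<longleftrightarrow> \<not> matching h N (M \<union> M')"

definition residual ::
    "host \<Rightarrow> nat \<Rightarrow> nat set set set \<Rightarrow> nat set set \<Rightarrow> nat set set set" where
  "residual h N MM F =
     {M - F | M. M \<in> MM \<and> M \<noteq> F \<and> M \<inter> F \<noteq> {} \<and> \<not> conflict h N F M}"

definition delta_sparse ::
    "host \<Rightarrow> nat \<Rightarrow> nat set set set \<Rightarrow> (nat \<Rightarrow> nat) \<Rightarrow> real \<Rightarrow> bool" where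
  "delta_sparse h N MM d \<delta> \<longleftrightarrow>
     (\<forall>M\<in>MM. \<forall>M'\<in>MM. \<not> M \<subset> M') \<and>
     (\<Sum>j\<in>{i. of_size MM i \<noteq> {}}.
        real (d j) * pr_ext h (real N - 2 * real (max_size MM) + 2) j)
       < 1 / (8 * real (max_size MM)) - \<delta> \<and>
     (\<forall>F\<in>MM. (\<Sum>M\<in>residual h N MM F. pr_ext h (real N) (card M)) \<le> \<delta>) \<and>
     16 * real (max_size MM) * \<delta> < 1"

end

theory Submission
  imports Defs
begin

text \<open>Reveal the matchings of the family one at a time: the avoidance probability is the product of
  the factors \<open>1 - P(A_M | T avoided)\<close>, where \<open>T\<close> is the set of earlier matchings, so it suffices
  that each conditional probability equals \<open>P(A_M)\<close> up to a relative error \<open>o(1/\<mu>)\<close>. Both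
  inequalities come from transposing two possible partners \<open>v, w\<close> of a vertex \<open>u\<close>, which exchanges
  the perfect matchings through \<open>uv\<close> with those through \<open>uw\<close>.

  For the upper bound on \<open>P(A_M | T avoided)\<close>, the switch never creates a forbidden matching that
  does not conflict with \<open>uv\<close>, which gives negative dependence. The matchings in conflict with \<open>M\<close>
  are absorbed as in the local lemma; by regularity their total weight is \<open>O(r\<^sup>2\<mu>/N)\<close>.

  For the lower bound, discard from \<open>T\<close> everything that touches \<open>M\<close>. The reverse switch creates only
  forbidden matchings through \<open>w\<close>, of weight \<open>O(r\<mu>/N)\<close>, which over the at most \<open>r\<close> edges of \<open>M\<close>
  again gives \<open>O(r\<^sup>2\<mu>/N)\<close>. Restoring the matchings that share an edge with \<open>M\<close> costs \<open>O(\<delta>)\<close>, and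
  those in conflict with \<open>M\<close> cost nothing. Finally \<open>r\<^sup>2\<mu>\<^sup>2/N\<close> and \<open>\<delta>\<mu>\<close> tend to \<open>0\<close>.\<close>

section \<open>Counts of perfect matchings and elementary facts about matchings\<close>

text \<open>Working with counts instead of probabilities turns every bound on a conditional
  probability into an inequality between two counts, so no conditioning event has to be shown
  nonempty.\<close>

definition cnt :: "host \<Rightarrow> nat \<Rightarrow> nat set set \<Rightarrow> nat set set set \<Rightarrow> real" where
  "cnt h N M0 T = real (card {F \<in> perfect_matchings h N. M0 \<subseteq> F \<and> (\<forall>M\<in>T. \<not> M \<subseteq> F)})"

text \<open>Once \<open>k\<close> disjoint edges are fixed, this is the number of possible partners
  of an uncovered vertex \<open>u < N\<close>; it is real-valued to avoid truncated
  subtraction.\<close>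

fun partners :: "host \<Rightarrow> nat \<Rightarrow> nat \<Rightarrow> real" where
  "partners Complete N k = real N - (2 * real k + 1)"
| "partners Bipartite N k = real N - real k"

lemma edges_subset_Pow: "edges h N \<subseteq> Pow (verts h N)"
  by (cases h) auto

lemma finite_verts: "finite (verts h N)"
  by (cases h) auto

lemma finite_edges: "finite (edges h N)"
  by (meson edges_subset_Pow finite_verts finite_Pow_iff finite_subset)

lemma edge_nonempty: "e \<in> edges h N \<Longrightarrow> e \<noteq> {}"
  by (cases h) auto

lemma card_edge: "e \<in> edges h N \<Longrightarrow> card e = 2"
  by (cases h) auto

lemma matching_finite: "matching h N M \<Longrightarrow> finite M"
  unfolding matching_def using finite_edges finite_subset by blast

lemma matching_subset: "matching h N M \<Longrightarrow> M' \<subseteq> M \<Longrightarrow> matching h N M'"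
  unfolding matching_def by (meson order_trans pairwise_subset)

lemma matching_edge_unique:
  "matching h N M \<Longrightarrow> e \<in> M \<Longrightarrow> f \<in> M \<Longrightarrow> x \<in> e \<Longrightarrow> x \<in> f \<Longrightarrow> e = f"
  unfolding matching_def pairwise_def disjnt_def by blast

lemma card_Union_matching:
  assumes "matching h N M" shows "card (\<Union>M) = 2 * card M"
proof -
  have "finite e" if "e \<in> M" for e
    using assms that card_edge[of e h N] by (intro card_ge_0_finite) (auto simp: matching_def)
  then have "card (\<Union>M) = sum card M"
    using assms by (intro card_Union_disjoint) (auto simp: matching_def)
  also have "\<dots> = (\<Sum>e\<in>M. 2)"
    using assms card_edge unfolding matching_def by (intro sum.cong) auto
  finally show ?thesis by simp
qed

lemma Union_matching_subset: "matching h N M \<Longrightarrow> \<Union>M \<subseteq> verts h N"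
  unfolding matching_def using edges_subset_Pow by blast

lemma finite_matchings: "finite {M. matching h N M}"
  by (rule finite_subset[of _ "Pow (edges h N)"]) (auto simp: matching_def finite_edges)

lemma finite_matching_family:
  assumes "\<And>M. M \<in> MM \<Longrightarrow> matching h N M" shows "finite MM"
  by (rule finite_subset[OF _ finite_matchings[of h N]]) (use assms in auto)

lemma finite_perfect_matchings: "finite (perfect_matchings h N)"
  by (rule finite_subset[OF _ finite_matchings[of h N]]) (auto simp: perfect_matchings_def)

text \<open>Choosing \<open>u < N\<close> puts \<open>u\<close> into the left class of
  \<open>Bipartite\<close>, which is the side from which \<open>card_partners\<close>
  counts.\<close>

lemma edge_endpoints:
  assumes "e \<in> edges h N"
  obtains u v where "e = {u, v}" "u \<noteq> v" "u < N"
  using assms by (cases h) force+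

lemma edges_neq: "{u, w} \<in> edges h N \<Longrightarrow> u \<noteq> w"
  by (cases h) (auto simp: doubleton_eq_iff)

lemma pair_in_edges_Complete: "{a, b} \<in> edges Complete N \<longleftrightarrow> a < N \<and> b < N \<and> a \<noteq> b"
  by (auto simp: doubleton_eq_iff)

lemma pair_in_edges_Bipartite:
  "{a, b} \<in> edges Bipartite N \<longleftrightarrow>
     a < N \<and> N \<le> b \<and> b < 2 * N \<or> b < N \<and> N \<le> a \<and> a < 2 * N"
  by (auto simp: doubleton_eq_iff)

text \<open>For \<open>Complete\<close>, exactly \<open>u\<close> and the \<open>2 * card M\<close>
  covered vertices are excluded. For \<open>Bipartite\<close>, only the right class matters, and
  each edge of \<open>M\<close> covers one vertex there.\<close>

lemma card_partners:
  assumes M: "matching h N M" and u: "u < N" "u \<notin> \<Union>M"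
  shows "real (card {w. {u, w} \<in> edges h N \<and> w \<notin> \<Union>M}) = partners h N (card M)"
proof (cases h)
  case Complete
  have eq: "{w. {u, w} \<in> edges h N \<and> w \<notin> \<Union>M} = {..<N} - insert u (\<Union>M)"
    using u by (auto simp: Complete pair_in_edges_Complete simp del: edges.simps)
  have sub: "insert u (\<Union>M) \<subseteq> {..<N}"
    using u Union_matching_subset[OF M] by (auto simp: Complete)
  have fin: "finite (insert u (\<Union>M))" by (rule finite_subset[OF sub]) simp
  have c: "card (insert u (\<Union>M)) = 2 * card M + 1"
    using u fin card_Union_matching[OF M] by simp
  have "2 * card M + 1 \<le> N" using card_mono[OF _ sub] c by simp
  then show ?thesis
    unfolding eq card_Diff_subset[OF fin sub] c by (simp add: Complete of_nat_diff)
next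
  case Bipartite
  let ?R = "\<Union>M \<inter> {N..<2 * N}"
  have eq: "{w. {u, w} \<in> edges h N \<and> w \<notin> \<Union>M} = {N..<2 * N} - ?R"
    using u by (auto simp: Bipartite pair_in_edges_Bipartite simp del: edges.simps)
  have E: "\<exists>a b. e = {a, b} \<and> a < N \<and> N \<le> b \<and> b < 2 * N" if "e \<in> M" for e
    using M that unfolding matching_def Bipartite by auto
  \<comment> \<open>Right vertices carry the larger numbers, so \<open>Max\<close> selects the right
    end of an edge.\<close>
  have "?R = Max ` M"
  proof (intro equalityI subsetI)
    fix x assume "x \<in> ?R"
    then obtain e where e: "e \<in> M" "x \<in> e" "N \<le> x" by auto
    with E[OF e(1)] have "x = Max e" by auto
    then show "x \<in> Max ` M" using e by auto
  next
    fix x assume "x \<in> Max ` M"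
    then obtain e where e: "e \<in> M" "x = Max e" by auto
    with E[OF e(1)] show "x \<in> ?R" using e(1) by (auto simp: max_def)
  qed
  moreover have "inj_on Max M"
  proof (rule inj_onI)
    fix e f assume ef: "e \<in> M" "f \<in> M" "Max e = Max f"
    have "Max e \<in> e" "Max f \<in> f" using E[OF ef(1)] E[OF ef(2)] by (auto simp: max_def)
    then show "e = f" using matching_edge_unique[OF M ef(1,2)] ef(3) by metis
  qed
  ultimately have c: "card ?R = card M" by (simp add: card_image)
  have "card M \<le> N" using card_mono[of "{N..<2 * N}" ?R] c by simp
  then show ?thesis
    unfolding eq by (subst card_Diff_subset) (auto simp: c Bipartite of_nat_diff)
qed

lemma perfect_matchings_nonempty:
  assumes "h = Complete \<Longrightarrow> even N"
  shows "perfect_matchings h N \<noteq> {}"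
proof (cases h)
  case Complete
  let ?F = "(\<lambda>i. {2 * i, 2 * i + 1}) ` {..<N div 2}"
  have "even N" using assms Complete by simp
  then have N: "2 * (N div 2) = N" by simp
  have lt: "2 * i + 1 < N" if "i < N div 2" for i using that by linarith
  have "matching h N ?F"
    unfolding matching_def
  proof
    show "?F \<subseteq> edges h N" unfolding Complete using lt by fastforce
    \<comment> \<open>An overlap of the form \<open>2 * i = 2 * j + 1\<close> is refuted by
      parity.\<close>
    show "pairwise disjnt ?F" by (rule pairwiseI) (auto simp: disjnt_def dest: arg_cong[where f = even])
  qed
  moreover have "\<Union>?F = verts h N"
  proof (intro equalityI subsetI)
    fix x assume "x \<in> verts h N"
    then have "x div 2 < N div 2" "x = 2 * (x div 2) \<or> x = 2 * (x div 2) + 1"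
      using N by (auto simp: Complete)
    then show "x \<in> \<Union>?F" by blast
  qed (use lt in \<open>fastforce simp: Complete\<close>)
  ultimately show ?thesis unfolding perfect_matchings_def by blast
next
  case Bipartite
  let ?F = "(\<lambda>i. {i, N + i}) ` {..<N}"
  have "matching h N ?F"
    unfolding matching_def
  proof
    show "?F \<subseteq> edges h N" unfolding Bipartite by fastforce
    show "pairwise disjnt ?F" by (rule pairwiseI) (auto simp: disjnt_def)
  qed
  moreover have "\<Union>?F = verts h N"
  proof (intro equalityI subsetI)
    fix x assume "x \<in> verts h N"
    then have "x < N \<or> (x = N + (x - N) \<and> x - N < N)"
      by (auto simp: Bipartite)
    then show "x \<in> \<Union>?F" by auto
  qed (auto simp: Bipartite)
  ultimately show ?thesis unfolding perfect_matchings_def by blast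
qed

subsection \<open>Switching\<close>

text \<open>Relabelling vertices, rather than exchanging edges, makes the switch an involution that
  preserves disjointness and inclusion with no case analysis.\<close>

abbreviation switch :: "nat \<Rightarrow> nat \<Rightarrow> nat set set \<Rightarrow> nat set set" where
  "switch v w F \<equiv> (\<lambda>e. Transposition.transpose v w ` e) ` F"

lemma switch_switch: "switch v w (switch v w F) = F"
  by (simp add: image_image)

lemma switch_mono: "A \<subseteq> B \<Longrightarrow> switch v w A \<subseteq> switch v w B"
  by blast

text \<open>The common neighbour \<open>u\<close> forces \<open>v\<close> and \<open>w\<close> into
  the same class when the host is bipartite, so the transposition respects the classes.\<close>

lemma transpose_image_edge:
  assumes "{u, v} \<in> edges h N" "{u, w} \<in> edges h N" "e \<in> edges h N"
  shows "Transposition.transpose v w ` e \<in> edges h N"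
proof (cases h)
  case Complete
  from assms(1,2) have vw: "v < N" "w < N"
    unfolding Complete pair_in_edges_Complete by auto
  obtain a b where ab: "e = {a, b}" "a < N" "b < N" "a \<noteq> b"
    using assms(3) by (auto simp: Complete)
  have "Transposition.transpose v w a \<noteq> Transposition.transpose v w b"
    using ab(4) by (metis transpose_involutory)
  moreover have "Transposition.transpose v w a < N" "Transposition.transpose v w b < N"
    using vw ab by (simp_all add: Transposition.transpose_def)
  ultimately show ?thesis
    unfolding Complete ab(1) image_insert image_empty pair_in_edges_Complete by simp
next
  case Bipartite
  have side: "v < N \<and> w < N \<or> N \<le> v \<and> v < 2 * N \<and> N \<le> w \<and> w < 2 * N"
    using assms(1,2) unfolding Bipartite pair_in_edges_Bipartite by linarith
  obtain a b where ab: "e = {a, b}" "a < N" "N \<le> b" "b < 2 * N"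
    using assms(3) by (auto simp: Bipartite)
  have "Transposition.transpose v w a < N" "N \<le> Transposition.transpose v w b"
    "Transposition.transpose v w b < 2 * N"
    using side ab by (auto simp: Transposition.transpose_def)
  then show ?thesis
    unfolding Bipartite ab(1) image_insert image_empty pair_in_edges_Bipartite by simp
qed

lemma switch_perfect_matching:
  assumes "{u, v} \<in> edges h N" "{u, w} \<in> edges h N" "F \<in> perfect_matchings h N"
  shows "switch v w F \<in> perfect_matchings h N"
proof -
  have F: "F \<subseteq> edges h N" "pairwise disjnt F" "\<Union>F = verts h N"
    using assms(3) by (auto simp: perfect_matchings_def matching_def)
  have "switch v w F \<subseteq> edges h N" using F(1) transpose_image_edge[OF assms(1,2)] by blast
  moreover have "pairwise disjnt (switch v w F)"
  proof (rule pairwiseI)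
    fix a b assume "a \<in> switch v w F" "b \<in> switch v w F" "a \<noteq> b"
    then obtain e f where ef: "e \<in> F" "f \<in> F" "a = Transposition.transpose v w ` e"
      "b = Transposition.transpose v w ` f" "e \<noteq> f" by auto
    then have "e \<inter> f = {}" using F(2) by (auto simp: pairwise_def disjnt_def)
    then show "disjnt a b" unfolding disjnt_def ef
      by (metis image_Int image_empty inj_transpose)
  qed
  moreover have "\<Union>(switch v w F) = verts h N"
  proof -
    have vw: "v \<in> verts h N" "w \<in> verts h N"
      using assms(1,2) edges_subset_Pow by blast+
    have "\<Union>(switch v w F) = Transposition.transpose v w ` verts h N"
      using F(3) by blast
    also have "\<dots> = verts h N" using vw by (simp add: transpose_image_eq)
    finally show ?thesis .
  qed
  ultimately show ?thesis by (simp add: perfect_matchings_def matching_def)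
qed

lemma switch_fixed:
  assumes "v \<notin> \<Union>M" "w \<notin> \<Union>M" shows "switch v w M = M"
proof -
  have "Transposition.transpose v w ` e = e" if "e \<in> M" for e
  proof -
    have "Transposition.transpose v w x = x" if "x \<in> e" for x
      using assms \<open>e \<in> M\<close> that by (auto simp: Transposition.transpose_def)
    then show ?thesis by force
  qed
  then show ?thesis by force
qed

text \<open>The switch is an involution, hence injective. In \<open>B\<close> the matching
  \<open>F\<close> plays the image and \<open>switch v w F\<close> the original: a forbidden member
  in the image must be traceable to one in the original.\<close>

lemma cnt_switch_le:
  assumes e: "{u, v} \<in> edges h N" "{u, w} \<in> edges h N"
    and A: "switch v w M1 = M2"
    and B: "\<And>F M. F \<in> perfect_matchings h N \<Longrightarrow> M2 \<subseteq> F \<Longrightarrow> M \<in> T' \<Longrightarrow> M \<subseteq> F \<Longrightarrow>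
      \<exists>M'\<in>T. M' \<subseteq> switch v w F"
  shows "cnt h N M1 T \<le> cnt h N M2 T'"
proof -
  let ?S = "\<lambda>M T. {F \<in> perfect_matchings h N. M \<subseteq> F \<and> (\<forall>M\<in>T. \<not> M \<subseteq> F)}"
  have "card (?S M1 T) \<le> card (?S M2 T')"
  proof (rule card_inj_on_le)
    show "inj_on (switch v w) (?S M1 T)"
      by (metis (no_types, lifting) inj_onI switch_switch)
    show "switch v w ` ?S M1 T \<subseteq> ?S M2 T'"
    proof safe
      fix F assume F: "F \<in> perfect_matchings h N" "M1 \<subseteq> F" "\<forall>M\<in>T. \<not> M \<subseteq> F"
      show G: "switch v w F \<in> perfect_matchings h N"
        by (rule switch_perfect_matching[OF e F(1)])
      have sub: "M2 \<subseteq> switch v w F" using A F(2) by blast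
      then show "x \<in> switch v w F" if "x \<in> M2" for x using that by blast
      fix M assume "M \<in> T'" "M \<subseteq> switch v w F"
      from B[OF G sub this] show False using F(3) by (simp add: switch_switch)
    qed
    show "finite (?S M2 T')" using finite_perfect_matchings by auto
  qed
  then show ?thesis by (simp add: cnt_def)
qed

lemma switch_insert_edge:
  assumes "u \<noteq> v" "u \<noteq> w" "v \<notin> \<Union>M0" "w \<notin> \<Union>M0"
  shows "switch v w (insert {u, v} M0) = insert {u, w} M0"
proof -
  have "switch v w (insert {u, v} M0) = insert (Transposition.transpose v w ` {u, v}) (switch v w M0)"
    by simp
  also have "Transposition.transpose v w ` {u, v} = {u, w}"
    using assms by (auto simp: Transposition.transpose_def)
  finally show ?thesis using switch_fixed[OF assms(3,4)] by simp
qed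

text \<open>A member of \<open>T\<close> created by the switch would touch \<open>v\<close> or \<open>w\<close>. It can touch \<open>v\<close> only through
  \<open>uv\<close>, which the switch removed, and \<open>w\<close> only through \<open>uw\<close>, which conflicts with \<open>uv\<close>.\<close>

lemma cnt_negative_switch:
  assumes e: "{u, v} \<in> edges h N" "{u, w} \<in> edges h N"
    and M0: "v \<notin> \<Union>M0" "w \<notin> \<Union>M0"
    and T: "\<And>M. M \<in> T \<Longrightarrow> matching h N (insert {u, v} M)"
  shows "cnt h N (insert {u, v} M0) T \<le> cnt h N (insert {u, w} M0) T"
proof (cases "v = w")
  case False
  have neq: "u \<noteq> v" "u \<noteq> w" using e edges_neq by auto
  show ?thesis
  proof (rule cnt_switch_le[OF e switch_insert_edge[OF neq M0]])
    fix F M assume F: "F \<in> perfect_matchings h N" "insert {u, w} M0 \<subseteq> F" "M \<in> T" "M \<subseteq> F"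
    have mF: "matching h N F" using F by (simp add: perfect_matchings_def)
    note mM = matching_edge_unique[OF T[OF F(3)]]
    have "v \<notin> \<Union>M"
    proof
      assume "v \<in> \<Union>M"
      then have "{u, v} \<in> M" using mM[of "{u, v}"] by auto
      then show False
        using matching_edge_unique[OF mF, of "{u, v}" "{u, w}" u] F False neq
        by (auto simp: doubleton_eq_iff)
    qed
    moreover have "w \<notin> \<Union>M"
    proof
      assume "w \<in> \<Union>M"
      then have "{u, w} \<in> M" using matching_edge_unique[OF mF, of "{u, w}" _ w] F by auto
      then show False using mM[of "{u, v}" "{u, w}" u] False neq by (auto simp: doubleton_eq_iff)
    qed
    ultimately have "switch v w M = M" by (rule switch_fixed)
    then show "\<exists>M'\<in>T. M' \<subseteq> switch v w F" using F(3) switch_mono[OF F(4), of v w] by auto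
  qed
qed simp

text \<open>A member of \<open>T\<close> misses \<open>v\<close> by assumption; if it also misses
  \<open>w\<close>, the switch fixes it and cannot create it. Only members through \<open>w\<close>
  can appear, and these are removed on the right.\<close>

lemma cnt_positive_switch:
  assumes e: "{u, v} \<in> edges h N" "{u, w} \<in> edges h N"
    and M0: "v \<notin> \<Union>M0" "w \<notin> \<Union>M0"
    and T: "\<And>M. M \<in> T \<Longrightarrow> v \<notin> \<Union>M"
  shows "cnt h N (insert {u, w} M0) T \<le> cnt h N (insert {u, v} M0) {M \<in> T. w \<notin> \<Union>M}"
proof -
  have neq: "u \<noteq> v" "u \<noteq> w" using e edges_neq by auto
  show ?thesis
  proof (rule cnt_switch_le[OF e(2,1)])
    show "switch w v (insert {u, w} M0) = insert {u, v} M0"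
      by (rule switch_insert_edge) (use neq M0 in auto)
    fix F M assume F: "M \<in> {M \<in> T. w \<notin> \<Union>M}" "M \<subseteq> F"
    then have "switch w v M = M" by (intro switch_fixed) (use T in auto)
    then show "\<exists>M'\<in>T. M' \<subseteq> switch w v F" using F(1) switch_mono[OF F(2), of w v] by auto
  qed
qed

section \<open>Averaging the switch over all partners of a vertex\<close>

text \<open>A perfect matching covers \<open>u\<close> by exactly one edge, so it can be classified
  by the partner of \<open>u\<close>.\<close>

lemma cnt_partition:
  assumes u: "u \<in> verts h N" "u \<notin> \<Union>M0"
  shows "cnt h N M0 T = (\<Sum>w | {u, w} \<in> edges h N \<and> w \<notin> \<Union>M0. cnt h N (insert {u, w} M0) T)"
proof -
  let ?S = "\<lambda>M. {F \<in> perfect_matchings h N. M \<subseteq> F \<and> (\<forall>M\<in>T. \<not> M \<subseteq> F)}"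
  let ?W = "{w. {u, w} \<in> edges h N \<and> w \<notin> \<Union>M0}"
  have finW: "finite ?W"
    by (rule finite_subset[OF _ finite_verts[of h N]]) (use edges_subset_Pow in blast)
  have "?S M0 = (\<Union>w\<in>?W. ?S (insert {u, w} M0))"
  proof (intro equalityI subsetI)
    fix F assume F: "F \<in> ?S M0"
    then have mF: "matching h N F" "\<Union>F = verts h N" by (auto simp: perfect_matchings_def)
    obtain e where e: "e \<in> F" "u \<in> e" using mF u by blast
    then have "e \<in> edges h N" using mF by (auto simp: matching_def)
    with e(2) obtain w where w: "e = {u, w}"
      by (metis edge_endpoints insert_commute insertE singletonD)
    \<comment> \<open>Otherwise the edge of \<open>M0\<close> at \<open>w\<close> would be
      \<open>e\<close>, and \<open>M0\<close> would cover \<open>u\<close>.\<close>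
    have "w \<notin> \<Union>M0"
    proof
      assume "w \<in> \<Union>M0"
      then obtain f where "f \<in> M0" "w \<in> f" by auto
      then have "e = f" using matching_edge_unique[OF mF(1) e(1), of f w] F w by auto
      then show False using \<open>f \<in> M0\<close> e u by auto
    qed
    then show "F \<in> (\<Union>w\<in>?W. ?S (insert {u, w} M0))" using F e w \<open>e \<in> edges h N\<close> by auto
  qed auto
  moreover have "card (\<Union>w\<in>?W. ?S (insert {u, w} M0)) = (\<Sum>w\<in>?W. card (?S (insert {u, w} M0)))"
  proof (rule card_UN_disjoint[OF finW])
    show "\<forall>w\<in>?W. finite (?S (insert {u, w} M0))" using finite_perfect_matchings by auto
    show "\<forall>w\<in>?W. \<forall>w'\<in>?W. w \<noteq> w' \<longrightarrow> ?S (insert {u, w} M0) \<inter> ?S (insert {u, w'} M0) = {}"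
    proof (intro ballI impI)
      fix w w' assume "w \<in> ?W" "w' \<in> ?W" "w \<noteq> w'"
      have False if "F \<in> perfect_matchings h N" "{u, w} \<in> F" "{u, w'} \<in> F" for F
        using that matching_edge_unique[of h N F "{u, w}" "{u, w'}" u] \<open>w \<noteq> w'\<close>
        by (auto simp: perfect_matchings_def doubleton_eq_iff)
      then show "?S (insert {u, w} M0) \<inter> ?S (insert {u, w'} M0) = {}" by blast
    qed
  qed
  ultimately show ?thesis unfolding cnt_def by simp
qed

lemma matching_insert_new:
  assumes "matching h N (insert e M0)" "e \<notin> M0" "x \<in> e"
  shows "x \<notin> \<Union>M0"
  using matching_edge_unique[OF assms(1), of e _ x] assms by auto

text \<open>By \<open>cnt_negative_switch\<close>, the partner prescribed by \<open>e\<close> is the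
  least frequent one, so its count is at most the average over all partners.\<close>

lemma cnt_edge_le:
  assumes m: "matching h N (insert e M0)" "e \<notin> M0"
    and T: "\<And>M. M \<in> T \<Longrightarrow> matching h N (insert e M)"
  shows "partners h N (card M0) * cnt h N (insert e M0) T \<le> cnt h N M0 T"
proof -
  have e: "e \<in> edges h N" using m by (auto simp: matching_def)
  then obtain u v where uv: "e = {u, v}" "u \<noteq> v" "u < N" by (rule edge_endpoints)
  have new: "u \<notin> \<Union>M0" "v \<notin> \<Union>M0" using matching_insert_new[OF m] uv by auto
  have u: "u \<in> verts h N" using e edges_subset_Pow uv by blast
  have mM0: "matching h N M0" using m matching_subset by blast
  let ?W = "{w. {u, w} \<in> edges h N \<and> w \<notin> \<Union>M0}"
  have "partners h N (card M0) * cnt h N (insert e M0) T = (\<Sum>w\<in>?W. cnt h N (insert e M0) T)"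
    using card_partners[OF mM0 uv(3) new(1)] by simp
  also have "\<dots> \<le> (\<Sum>w\<in>?W. cnt h N (insert {u, w} M0) T)"
    unfolding uv(1) by (intro sum_mono cnt_negative_switch) (use e uv new T in auto)
  also have "\<dots> = cnt h N M0 T" by (rule cnt_partition[OF u new(1), symmetric])
  finally show ?thesis .
qed

text \<open>The reverse averaging argument. The factor \<open>b\<close> is the price for putting the
  members through \<open>w\<close> back; it stays a parameter here and becomes
  \<open>1 - 4 * w\<close>, with \<open>w\<close> the vertex weight, through
  \<open>cnt_drop_vertex\<close>.\<close>

lemma cnt_edge_ge:
  assumes m: "matching h N (insert e M0)" "e \<notin> M0"
    and T: "\<And>M. M \<in> T \<Longrightarrow> e \<inter> \<Union>M = {}"
    and b: "\<And>w. b * cnt h N (insert e M0) {M \<in> T. w \<notin> \<Union>M} \<le> cnt h N (insert e M0) T" "b \<ge> 0"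
  shows "b * cnt h N M0 T \<le> partners h N (card M0) * cnt h N (insert e M0) T"
proof -
  have e: "e \<in> edges h N" using m by (auto simp: matching_def)
  then obtain u v where uv: "e = {u, v}" "u \<noteq> v" "u < N" by (rule edge_endpoints)
  have new: "u \<notin> \<Union>M0" "v \<notin> \<Union>M0" using matching_insert_new[OF m] uv by auto
  have u: "u \<in> verts h N" using e edges_subset_Pow uv by blast
  have mM0: "matching h N M0" using m matching_subset by blast
  let ?W = "{w. {u, w} \<in> edges h N \<and> w \<notin> \<Union>M0}"
  have "b * cnt h N M0 T = (\<Sum>w\<in>?W. b * cnt h N (insert {u, w} M0) T)"
    by (subst cnt_partition[OF u new(1)]) (simp add: sum_distrib_left)
  also have "\<dots> \<le> (\<Sum>w\<in>?W. b * cnt h N (insert e M0) {M \<in> T. w \<notin> \<Union>M})"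
    unfolding uv(1) using e uv new T
    by (intro sum_mono mult_left_mono cnt_positive_switch b) auto
  also have "\<dots> \<le> (\<Sum>w\<in>?W. cnt h N (insert e M0) T)"
    by (intro sum_mono b)
  also have "\<dots> = partners h N (card M0) * cnt h N (insert e M0) T"
    using card_partners[OF mM0 uv(3) new(1)] by simp
  finally show ?thesis .
qed

section \<open>Extension weights, union bounds and negative dependence\<close>

text \<open>For admissible sizes this is the conditional probability that \<open>i\<close> further
  edges occur in a uniform perfect matching, given that \<open>k\<close> compatible edges
  do.\<close>

definition ext_wt :: "host \<Rightarrow> nat \<Rightarrow> nat \<Rightarrow> nat \<Rightarrow> real" where
  "ext_wt h N k i = 1 / (\<Prod>j<i. partners h N (k + j))"

lemma ext_wt_0: "ext_wt h N 0 i = pr_ext h (real N) i"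
  by (cases h) (simp_all add: ext_wt_def)

lemma ext_wt_Suc: "ext_wt h N k (Suc i) = ext_wt h N k i / partners h N (k + i)"
  by (simp add: ext_wt_def)

lemma partners_lower: "real N - 2 * real k - 1 \<le> partners h N k"
  by (cases h) auto

lemma partners_pos: "2 * k + 1 < N \<Longrightarrow> partners h N k > 0"
  using partners_lower[of N k h] by linarith

lemma ext_wt_pos: "2 * (k + i) \<le> N \<Longrightarrow> ext_wt h N k i > 0"
  unfolding ext_wt_def by (auto intro!: prod_pos partners_pos)

lemma matching_Un:
  assumes "matching h N A" "matching h N B" "\<Union>A \<inter> \<Union>B = {}"
  shows "matching h N (A \<union> B)"
  unfolding matching_def
proof
  show "A \<union> B \<subseteq> edges h N" using assms by (simp add: matching_def)
  show "pairwise disjnt (A \<union> B)"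
  proof (rule pairwiseI)
    fix e f assume "e \<in> A \<union> B" "f \<in> A \<union> B" "e \<noteq> f"
    then consider "e \<in> A" "f \<in> A" | "e \<in> B" "f \<in> B" | "e \<in> A" "f \<in> B" | "e \<in> B" "f \<in> A"
      by blast
    then show "disjnt e f"
    proof cases
      case 1
      then show ?thesis using assms(1) \<open>e \<noteq> f\<close> unfolding matching_def by (blast dest: pairwiseD)
    next
      case 2
      then show ?thesis using assms(2) \<open>e \<noteq> f\<close> unfolding matching_def by (blast dest: pairwiseD)
    next
      case 3
      then have "e \<subseteq> \<Union>A" "f \<subseteq> \<Union>B" by auto
      then show ?thesis using assms(3) by (auto simp: disjnt_def)
    next
      case 4
      then have "e \<subseteq> \<Union>B" "f \<subseteq> \<Union>A" by auto
      then show ?thesis using assms(3) by (auto simp: disjnt_def)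
    qed
  qed
qed

lemma matching_Int_empty:
  assumes "matching h N B" "\<Union>A \<inter> \<Union>B = {}"
  shows "A \<inter> B = {}"
proof -
  have "e \<noteq> {}" if "e \<in> B" for e
    using assms(1) that edge_nonempty unfolding matching_def by blast
  then show ?thesis using assms(2) by blast
qed

lemma cnt_nonneg: "cnt h N M T \<ge> 0"
  by (simp add: cnt_def)

lemma cnt_mono:
  assumes "M2 \<subseteq> M1" "T2 \<subseteq> T1"
  shows "cnt h N M1 T1 \<le> cnt h N M2 T2"
  unfolding cnt_def of_nat_le_iff using assms finite_perfect_matchings[of h N]
  by (intro card_mono) auto

text \<open>The witnesses \<open>Xs\<close> are decoupled from \<open>T\<close>, so that they may be
  members of \<open>T\<close> or only their parts outside \<open>M0\<close>.\<close>

lemma cnt_union_bound: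
  assumes fin: "finite Xs"
    and hit: "\<And>F M. F \<in> perfect_matchings h N \<Longrightarrow> M0 \<subseteq> F \<Longrightarrow> \<forall>M\<in>T1. \<not> M \<subseteq> F \<Longrightarrow>
      M \<in> T \<Longrightarrow> M \<subseteq> F \<Longrightarrow> \<exists>X\<in>Xs. X \<subseteq> F"
  shows "cnt h N M0 T1 \<le> cnt h N M0 T + (\<Sum>X\<in>Xs. cnt h N (M0 \<union> X) T1)"
proof -
  let ?S = "\<lambda>M T. {F \<in> perfect_matchings h N. M \<subseteq> F \<and> (\<forall>M\<in>T. \<not> M \<subseteq> F)}"
  have fS: "finite (?S M T)" for M T using finite_perfect_matchings by auto
  have "?S M0 T1 \<subseteq> ?S M0 T \<union> (\<Union>X\<in>Xs. ?S (M0 \<union> X) T1)"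
    using hit by fastforce
  then have "card (?S M0 T1) \<le> card (?S M0 T \<union> (\<Union>X\<in>Xs. ?S (M0 \<union> X) T1))"
    by (rule card_mono[rotated]) (use fS fin in blast)
  also have "\<dots> \<le> card (?S M0 T) + card (\<Union>X\<in>Xs. ?S (M0 \<union> X) T1)"
    by (rule card_Un_le)
  also have "\<dots> \<le> card (?S M0 T) + (\<Sum>X\<in>Xs. card (?S (M0 \<union> X) T1))"
    by (intro add_left_mono card_UN_le fin)
  finally have "real (card (?S M0 T1)) \<le> real (card (?S M0 T) + (\<Sum>X\<in>Xs. card (?S (M0 \<union> X) T1)))"
    unfolding of_nat_le_iff .
  then show ?thesis unfolding cnt_def by simp
qed

text \<open>Divided by \<open>cnt h N M0 T\<close>, this is the factor
  \<open>1 - P(M | T avoided)\<close> that arises when one more member is revealed.\<close>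

lemma cnt_insert:
  "cnt h N M0 (insert M T) = cnt h N M0 T - cnt h N (M0 \<union> M) T"
proof -
  let ?S = "\<lambda>M T. {F \<in> perfect_matchings h N. M \<subseteq> F \<and> (\<forall>M\<in>T. \<not> M \<subseteq> F)}"
  have fS: "finite (?S M T)" for M T using finite_perfect_matchings by auto
  have eq: "?S M0 T = ?S M0 (insert M T) \<union> ?S (M0 \<union> M) T" by blast
  have "card (?S M0 T) = card (?S M0 (insert M T)) + card (?S (M0 \<union> M) T)"
    unfolding eq by (rule card_Un_disjoint[OF fS fS]) blast
  then show ?thesis by (simp add: cnt_def)
qed

text \<open>Insert the edges of \<open>M\<close> one at a time with \<open>cnt_edge_le\<close>; a
  member of \<open>T\<close> compatible with all of \<open>M\<close> is compatible with each of its
  edges.\<close>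

lemma cnt_matching_le:
  assumes "finite M" "matching h N (M0 \<union> M)" "M0 \<inter> M = {}"
    and "\<And>M'. M' \<in> T \<Longrightarrow> matching h N (M' \<union> M)"
    and "2 * (card M0 + card M) \<le> N"
  shows "cnt h N (M0 \<union> M) T \<le> ext_wt h N (card M0) (card M) * cnt h N M0 T"
  using assms
proof (induction M rule: finite_induct)
  case empty
  then show ?case by (simp add: ext_wt_def)
next
  case (insert e M)
  have fin0: "finite M0" using matching_finite[OF insert.prems(1)] by simp
  have card: "card (M0 \<union> M) = card M0 + card M"
    using insert.prems insert.hyps fin0 by (intro card_Un_disjoint) auto
  have pos: "partners h N (card M0 + card M) > 0"
    using insert.prems(4) insert.hyps by (intro partners_pos) simp
  have IH: "cnt h N (M0 \<union> M) T \<le> ext_wt h N (card M0) (card M) * cnt h N M0 T"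
  proof (rule insert.IH)
    show "matching h N (M0 \<union> M)" by (rule matching_subset[OF insert.prems(1)]) auto
    show "matching h N (M' \<union> M)" if "M' \<in> T" for M'
      by (rule matching_subset[OF insert.prems(3)[OF that]]) auto
  qed (use insert.prems insert.hyps in auto)
  have "partners h N (card (M0 \<union> M)) * cnt h N (insert e (M0 \<union> M)) T \<le> cnt h N (M0 \<union> M) T"
  proof (rule cnt_edge_le)
    show "matching h N (insert e M')" if "M' \<in> T" for M'
      by (rule matching_subset[OF insert.prems(3)[OF that]]) auto
  qed (use insert.prems insert.hyps in auto)
  with IH have "partners h N (card M0 + card M) * cnt h N (M0 \<union> insert e M) T
      \<le> ext_wt h N (card M0) (card M) * cnt h N M0 T"
    unfolding card by simp
  then show ?case using pos insert.hyps by (simp add: ext_wt_Suc field_simps)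
qed

subsection \<open>Local lemma estimates\<close>

text \<open>Regularity enters only through \<open>weight\<close>, a bound on the total weight of the
  members at one vertex. \<open>r_small\<close> keeps extension weights within a factor 2 of
  \<open>p\<close>, and \<open>w_small\<close> keeps the local lemma loss \<open>8 * r * w\<close>
  at most 1/2.\<close>

locale light_family =
  fixes h :: host and N :: nat and MM :: "nat set set set" and r :: nat and w :: real
  assumes host_even: "h = Complete \<Longrightarrow> even N"
    and matching: "M \<in> MM \<Longrightarrow> matching h N M"
    and nonempty: "M \<in> MM \<Longrightarrow> M \<noteq> {}"
    and card_le: "M \<in> MM \<Longrightarrow> card M \<le> r"
    and r_pos: "1 \<le> r" and r_small: "8 * r\<^sup>2 \<le> N"
    and weight: "(\<Sum>M | M \<in> MM \<and> v \<in> \<Union>M. pr_ext h (real N) (card M)) \<le> w"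
    and w_small: "16 * real r * w \<le> 1"
begin

abbreviation p :: "nat \<Rightarrow> real" where "p i \<equiv> pr_ext h (real N) i"

lemma r_linear: "8 * r \<le> N"
proof -
  have "r \<le> r\<^sup>2" using r_pos by (simp add: power2_eq_square)
  then show ?thesis using r_small by simp
qed

lemma p_pos: "i \<le> r \<Longrightarrow> p i > 0"
  unfolding ext_wt_0[symmetric] by (rule ext_wt_pos) (use r_linear in simp)

lemma finite_family: "finite MM"
  using matching by (rule finite_matching_family)

lemma w_nonneg: "0 \<le> w"
proof (rule order_trans[OF sum_nonneg weight])
  \<comment> \<open>Any vertex serves for \<open>weight\<close>; \<open>undefined\<close> is an
    arbitrary choice.\<close>
  show "0 \<le> p (card M)" if "M \<in> {M. M \<in> MM \<and> undefined \<in> \<Union>M}" for M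
    using p_pos[OF card_le, of M] that by simp
qed

text \<open>Fixing \<open>k\<close> edges lowers each partner count by a relative amount of at most
  \<open>x = 2r/D\<close>. There are at most \<open>r\<close> factors and \<open>r * x\<close> is at
  most 1/2, so by Bernoulli the product keeps at least half of its value.\<close>

lemma ext_wt_le:
  assumes "k \<le> r" "i \<le> r"
  shows "ext_wt h N k i \<le> 2 * p i"
proof -
  define D where "D = real N - 2 * real r - 1"
  have r2: "8 * (real r)\<^sup>2 \<le> real N" using r_small by (metis of_nat_le_iff of_nat_mult of_nat_numeral of_nat_power)
  have rr: "real r \<le> (real r)\<^sup>2" using r_pos by (simp add: power2_eq_square)
  have r1: "1 \<le> real r" using r_pos by simp
  \<comment> \<open>Both \<open>2r\<close> and \<open>1\<close> are absorbed by multiples of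
    \<open>r^2\<close>, leaving at least \<open>4r^2\<close> of the \<open>8r^2\<close> in
    \<open>r_small\<close>.\<close>
  have D: "4 * (real r)\<^sup>2 \<le> D" using r1 rr r2 unfolding D_def by linarith
  have Dpos: "D > 0" using D rr r1 by linarith
  define x where "x = 2 * real r / D"
  have rx: "real r * x \<le> 1 / 2" using D Dpos by (simp add: x_def field_simps power2_eq_square)
  have x0: "0 \<le> x" using Dpos by (simp add: x_def)
  have x1: "x \<le> 1" using rx mult_right_mono[OF r1 x0] by simp
  have step: "(1 - x) * partners h N j \<le> partners h N (k + j)" if "j < i" for j
  proof -
    have "D \<le> partners h N j" using partners_lower[of N j h] that assms by (simp add: D_def)
    then have "x * partners h N j \<ge> x * D" using x0 by (rule mult_left_mono)
    also have "x * D = 2 * real r" using Dpos by (simp add: x_def)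
    finally have "x * partners h N j \<ge> 2 * real k" using assms by simp
    moreover have "partners h N j - 2 * real k \<le> partners h N (k + j)" by (cases h) auto
    ultimately show ?thesis by (simp add: algebra_simps)
  qed
  have pj: "partners h N j > 0" "partners h N (k + j) > 0" if "j < i" for j
    using that assms r_linear by (auto intro!: partners_pos)
  let ?A = "\<Prod>j<i. partners h N j" and ?B = "\<Prod>j<i. partners h N (k + j)"
  have A: "?A > 0" and B: "?B > 0" using pj by (auto intro!: prod_pos)
  have "1 / 2 \<le> 1 - real i * x"
    using rx mult_right_mono[of "real i" "real r" x] assms x0 by simp
  also have "\<dots> \<le> (1 - x) ^ i"
    using Bernoulli_inequality[of "- x" i] x1 by simp
  finally have "1 / 2 * ?A \<le> (1 - x) ^ i * ?A" using A by (intro mult_right_mono) auto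
  also have "\<dots> = (\<Prod>j<i. (1 - x) * partners h N j)" by (simp add: prod.distrib)
  also have "\<dots> \<le> ?B"
  proof (intro prod_mono conjI)
    fix j assume "j \<in> {..<i}"
    then show "0 \<le> (1 - x) * partners h N j" "(1 - x) * partners h N j \<le> partners h N (k + j)"
      using step[of j] pj(1)[of j] x1 by simp_all
  qed
  finally have "?A \<le> 2 * ?B" by simp
  then have "1 / ?B \<le> 2 * (1 / ?A)" using A B by (simp add: field_simps)
  then show ?thesis unfolding ext_wt_0[symmetric] by (simp add: ext_wt_def)
qed

text \<open>Charge each member of \<open>Tc\<close> to a vertex of \<open>V\<close> that it covers;
  no vertex receives more than \<open>w\<close>.\<close>

lemma sum_p_meeting_le:
  assumes "finite V" "Tc \<subseteq> MM" "\<And>M. M \<in> Tc \<Longrightarrow> V \<inter> \<Union>M \<noteq> {}"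
  shows "(\<Sum>M\<in>Tc. p (card M)) \<le> real (card V) * w"
proof -
  have p0: "0 \<le> p (card M)" if "M \<in> MM" for M using p_pos[OF card_le[OF that]] by simp
  have "(\<Sum>M\<in>Tc. p (card M)) \<le> (\<Sum>M\<in>Tc. \<Sum>v\<in>V. if v \<in> \<Union>M then p (card M) else 0)"
  proof (rule sum_mono)
    fix M assume M: "M \<in> Tc"
    then obtain v where v: "v \<in> V" "v \<in> \<Union>M" using assms(3) by blast
    have "p (card M) = (if v \<in> \<Union>M then p (card M) else 0)" using v by simp
    also have "\<dots> \<le> (\<Sum>v\<in>V. if v \<in> \<Union>M then p (card M) else 0)"
      by (rule member_le_sum) (use v assms M p0 in auto)
    finally show "p (card M) \<le> (\<Sum>v\<in>V. if v \<in> \<Union>M then p (card M) else 0)" .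
  qed
  also have "\<dots> \<le> (\<Sum>M\<in>MM. \<Sum>v\<in>V. if v \<in> \<Union>M then p (card M) else 0)"
    by (intro sum_mono2 finite_family assms(2) sum_nonneg) (use p0 in auto)
  also have "\<dots> = (\<Sum>v\<in>V. \<Sum>M | M \<in> MM \<and> v \<in> \<Union>M. p (card M))"
    by (subst sum.swap) (simp only: sum.inter_filter[OF finite_family])
  also have "\<dots> \<le> (\<Sum>v\<in>V. w)" by (intro sum_mono weight)
  finally show ?thesis by simp
qed

text \<open>The induction of the lopsided local lemma, run inside the space of perfect matchings that
  extend \<open>M0\<close>: conditioning on the matchings that do not conflict with \<open>M\<close> can only lower the
  probability of \<open>M\<close>, and those that do conflict meet one of the at most \<open>2r\<close> vertices of \<open>M\<close>.\<close>

lemma cnt_local: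
  assumes "T \<subseteq> MM" "\<And>M'. M' \<in> T \<Longrightarrow> \<Union>M' \<inter> \<Union>M0 = {}"
    and "card M0 \<le> r" "card M \<le> r" "matching h N (M0 \<union> M)" "M0 \<inter> M = {}"
  shows "(1 - 8 * real r * w) * cnt h N (M0 \<union> M) T \<le> ext_wt h N (card M0) (card M) * cnt h N M0 T"
  using assms
proof (induction "card T" arbitrary: T M rule: less_induct)
  case less
  let ?b = "1 - 8 * real r * w" and ?k = "card M0"
  have b: "1 / 2 \<le> ?b" "?b \<le> 1" using w_small w_nonneg by auto
  have finT: "finite T" using less.prems(1) finite_family finite_subset by blast
  have mM: "matching h N M" and mM0: "matching h N M0"
    using less.prems(5) matching_subset by blast+
  define Tc where "Tc = {M' \<in> T. \<not> matching h N (M' \<union> M)}"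
  define Tn where "Tn = T - Tc"
  have wt: "0 \<le> ext_wt h N ?k i" if "i \<le> r" for i
    using ext_wt_pos[of ?k i N h] that less.prems(3) r_linear by simp
  have neg: "cnt h N (M0 \<union> M) Tn \<le> ext_wt h N ?k (card M) * cnt h N M0 Tn"
  proof (rule cnt_matching_le)
    show "finite M" using mM by (rule matching_finite)
    show "matching h N (M' \<union> M)" if "M' \<in> Tn" for M' using that by (simp add: Tn_def Tc_def)
  qed (use less.prems r_linear in auto)
  have meet: "\<Union>M \<inter> \<Union>M' \<noteq> {}" if "M' \<in> Tc" for M'
  proof
    assume "\<Union>M \<inter> \<Union>M' = {}"
    moreover have "matching h N M'" using that less.prems(1) matching by (auto simp: Tc_def)
    ultimately have "matching h N (M' \<union> M)"
      using mM by (intro matching_Un) auto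
    then show False using that by (simp add: Tc_def)
  qed
  have sumc: "(\<Sum>M'\<in>Tc. p (card M')) \<le> 2 * real r * w"
  proof -
    have "(\<Sum>M'\<in>Tc. p (card M')) \<le> real (card (\<Union>M)) * w"
    proof (rule sum_p_meeting_le)
      show "finite (\<Union>M)" using Union_matching_subset[OF mM] finite_verts finite_subset by blast
    qed (use meet less.prems(1) in \<open>auto simp: Tc_def\<close>)
    also have "\<dots> \<le> 2 * real r * w"
      using card_Union_matching[OF mM] less.prems(4) w_nonneg by (intro mult_right_mono) auto
    finally show ?thesis .
  qed
  \<comment> \<open>\<open>Tn\<close> is smaller than \<open>T\<close> because \<open>M'\<close> has
    been removed. Of the constant 4, one factor 2 comes from \<open>?b\<close> being at least 1/2
    and the other from \<open>ext_wt_le\<close>.\<close>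
  have IH: "cnt h N (M0 \<union> M') Tn \<le> 4 * p (card M') * cnt h N M0 Tn" if "M' \<in> Tc" for M'
  proof -
    have M': "M' \<in> T" "M' \<in> MM" using that less.prems(1) by (auto simp: Tc_def)
    have lt: "card Tn < card T"
      using that M' finT by (intro psubset_card_mono) (auto simp: Tn_def)
    have dis: "\<Union>M' \<inter> \<Union>M0 = {}" using less.prems(2) M' by simp
    have mm: "matching h N (M0 \<union> M')"
      using mM0 matching[OF M'(2)] dis by (intro matching_Un) auto
    have "M0 \<inter> M' = {}" using dis by (intro matching_Int_empty[OF matching[OF M'(2)]]) auto
    then have "?b * cnt h N (M0 \<union> M') Tn \<le> ext_wt h N ?k (card M') * cnt h N M0 Tn"
      using less.prems M' card_le mm by (intro less.hyps[OF lt]) (auto simp: Tn_def)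
    moreover have "1 / 2 * cnt h N (M0 \<union> M') Tn \<le> ?b * cnt h N (M0 \<union> M') Tn"
      using b cnt_nonneg by (intro mult_right_mono) auto
    moreover have "ext_wt h N ?k (card M') * cnt h N M0 Tn \<le> 2 * p (card M') * cnt h N M0 Tn"
      using ext_wt_le[OF less.prems(3) card_le[OF M'(2)]] cnt_nonneg by (intro mult_right_mono) auto
    ultimately show ?thesis by simp
  qed
  have "cnt h N M0 Tn \<le> cnt h N M0 T + (\<Sum>M'\<in>Tc. cnt h N (M0 \<union> M') Tn)"
    by (rule cnt_union_bound) (use finT in \<open>auto simp: Tn_def Tc_def\<close>)
  also have "(\<Sum>M'\<in>Tc. cnt h N (M0 \<union> M') Tn) \<le> (\<Sum>M'\<in>Tc. 4 * p (card M') * cnt h N M0 Tn)"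
    by (intro sum_mono IH)
  also have "\<dots> = 4 * (\<Sum>M'\<in>Tc. p (card M')) * cnt h N M0 Tn"
    by (simp add: sum_distrib_left sum_distrib_right)
  also have "\<dots> \<le> 4 * (2 * real r * w) * cnt h N M0 Tn"
    by (intro mult_right_mono mult_left_mono sumc cnt_nonneg) auto
  \<comment> \<open>The loss \<open>4 * (2 * r * w)\<close> is exactly the \<open>8 * r * w\<close>
    in \<open>?b\<close>, so the induction reproduces its own constant.\<close>
  finally have low: "?b * cnt h N M0 Tn \<le> cnt h N M0 T" by (simp add: algebra_simps)
  have "?b * cnt h N (M0 \<union> M) T \<le> ?b * cnt h N (M0 \<union> M) Tn"
    using b by (intro mult_left_mono cnt_mono) (auto simp: Tn_def)
  also have "\<dots> \<le> ?b * (ext_wt h N ?k (card M) * cnt h N M0 Tn)"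
    using b neg by (intro mult_left_mono) auto
  also have "\<dots> = ext_wt h N ?k (card M) * (?b * cnt h N M0 Tn)" by simp
  also have "\<dots> \<le> ext_wt h N ?k (card M) * cnt h N M0 T"
    using low wt less.prems(4) by (intro mult_left_mono) auto
  finally show ?case .
qed

text \<open>A version with an absolute constant, for estimating error terms only.\<close>

lemma cnt_local_crude:
  assumes "T \<subseteq> MM" "\<And>M'. M' \<in> T \<Longrightarrow> \<Union>M' \<inter> \<Union>M0 = {}"
    and "card M0 \<le> r" "card M \<le> r" "matching h N (M0 \<union> M)" "M0 \<inter> M = {}"
  shows "cnt h N (M0 \<union> M) T \<le> 4 * p (card M) * cnt h N M0 T"
proof -
  have "1 / 2 * cnt h N (M0 \<union> M) T \<le> (1 - 8 * real r * w) * cnt h N (M0 \<union> M) T"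
    using w_small cnt_nonneg by (intro mult_right_mono) auto
  also have "\<dots> \<le> ext_wt h N (card M0) (card M) * cnt h N M0 T" by (rule cnt_local[OF assms])
  also have "\<dots> \<le> 2 * p (card M) * cnt h N M0 T"
    using ext_wt_le[OF assms(3,4)] cnt_nonneg by (intro mult_right_mono) auto
  finally show ?thesis by simp
qed

text \<open>Union bound over the members through \<open>x\<close>: by \<open>cnt_local_crude\<close>
  each has conditional probability at most four times its weight, and together they weigh at most
  \<open>w\<close>.\<close>

lemma cnt_drop_vertex:
  assumes "matching h N M0" "card M0 \<le> r" "T \<subseteq> MM" "\<And>M'. M' \<in> T \<Longrightarrow> \<Union>M' \<inter> \<Union>M0 = {}"
  shows "(1 - 4 * w) * cnt h N M0 {M \<in> T. x \<notin> \<Union>M} \<le> cnt h N M0 T"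
proof -
  let ?Tn = "{M \<in> T. x \<notin> \<Union>M}" and ?Tc = "{M \<in> T. x \<in> \<Union>M}"
  have finT: "finite T" using assms(3) finite_family finite_subset by blast
  have each: "cnt h N (M0 \<union> M') ?Tn \<le> 4 * p (card M') * cnt h N M0 ?Tn" if "M' \<in> ?Tc" for M'
  proof (rule cnt_local_crude)
    have M': "M' \<in> T" "M' \<in> MM" using that assms(3) by auto
    have dis: "\<Union>M' \<inter> \<Union>M0 = {}" using assms(4) M' by simp
    show "matching h N (M0 \<union> M')"
      using assms(1) matching[OF M'(2)] dis by (intro matching_Un) auto
    show "M0 \<inter> M' = {}" using dis by (intro matching_Int_empty[OF matching[OF M'(2)]]) auto
    show "card M' \<le> r" using card_le M' by simp
  qed (use assms in auto)
  have "cnt h N M0 ?Tn \<le> cnt h N M0 T + (\<Sum>M'\<in>?Tc. cnt h N (M0 \<union> M') ?Tn)"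
  proof (rule cnt_union_bound)
    show "finite ?Tc" using finT by simp
    fix F M assume F: "\<forall>M\<in>?Tn. \<not> M \<subseteq> F" "M \<in> T" "M \<subseteq> F"
    then have "M \<notin> ?Tn" by metis
    then have "M \<in> ?Tc" using F(2) by simp
    then show "\<exists>X\<in>?Tc. X \<subseteq> F" using F(3) by metis
  qed
  also have "(\<Sum>M'\<in>?Tc. cnt h N (M0 \<union> M') ?Tn) \<le> (\<Sum>M'\<in>?Tc. 4 * p (card M') * cnt h N M0 ?Tn)"
    by (intro sum_mono each)
  also have "\<dots> = 4 * (\<Sum>M'\<in>?Tc. p (card M')) * cnt h N M0 ?Tn"
    by (simp add: sum_distrib_left sum_distrib_right)
  also have "\<dots> \<le> 4 * w * cnt h N M0 ?Tn"
  proof (intro mult_right_mono mult_left_mono cnt_nonneg)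
    show "(\<Sum>M'\<in>?Tc. p (card M')) \<le> w"
      using sum_p_meeting_le[of "{x}" ?Tc] assms(3) by auto
  qed auto
  finally show ?thesis by (simp add: algebra_simps)
qed

text \<open>Switching \<open>uw\<close> to \<open>uv\<close> only creates forbidden matchings through \<open>w\<close>, and allowing these
  costs a factor \<open>1 - 4w\<close> of the count; this is paid once for each edge of \<open>M\<close>.\<close>

lemma cnt_near_positive_power:
  assumes "finite M" "matching h N M" "card M \<le> r" "T \<subseteq> MM" "\<And>M'. M' \<in> T \<Longrightarrow> \<Union>M' \<inter> \<Union>M = {}"
  shows "(1 - 4 * w) ^ card M * p (card M) * cnt h N {} T \<le> cnt h N M T"
  using assms
proof (induction M rule: finite_induct)
  case empty
  have "p 0 = 1" by (cases h) auto
  then show ?case by simp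
next
  case (insert e M)
  have w4: "0 \<le> 1 - 4 * w" 
    using w_small mult_right_mono[of 1 "real r" w] r_pos w_nonneg by simp
  have pos: "partners h N (card M) > 0"
    using insert.prems(2) insert.hyps r_linear by (intro partners_pos) simp
  have mM: "matching h N M" using insert.prems(1) matching_subset by blast
  have IH: "(1 - 4 * w) ^ card M * p (card M) * cnt h N {} T \<le> cnt h N M T"
    using insert.prems insert.hyps mM by (intro insert.IH) fastforce+
  have "(1 - 4 * w) * cnt h N M T \<le> partners h N (card M) * cnt h N (insert e M) T"
  proof (rule cnt_edge_ge)
    show "(1 - 4 * w) * cnt h N (insert e M) {M \<in> T. x \<notin> \<Union>M} \<le> cnt h N (insert e M) T" for x
      by (rule cnt_drop_vertex) (use insert.prems in auto)
    show "e \<inter> \<Union>M' = {}" if "M' \<in> T" for M' using insert.prems(4)[OF that] by auto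
  qed (use insert.prems insert.hyps w4 in auto)
  moreover have "(1 - 4 * w) * ((1 - 4 * w) ^ card M * p (card M) * cnt h N {} T) \<le> (1 - 4 * w) * cnt h N M T"
    using IH w4 by (rule mult_left_mono)
  ultimately have "(1 - 4 * w) * ((1 - 4 * w) ^ card M * p (card M) * cnt h N {} T)
      \<le> partners h N (card M) * cnt h N (insert e M) T" by linarith
  then have "(1 - 4 * w) * ((1 - 4 * w) ^ card M * p (card M) * cnt h N {} T) / partners h N (card M)
      \<le> cnt h N (insert e M) T"
    using pos by (simp add: pos_divide_le_eq mult.commute)
  moreover have "p (Suc (card M)) = p (card M) / partners h N (card M)"
    unfolding ext_wt_0[symmetric] by (simp add: ext_wt_Suc)
  ultimately show ?case using insert.hyps by (simp add: mult.assoc)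
qed

text \<open>Bernoulli's inequality makes the loss over all edges of \<open>M\<close> linear in
  \<open>r * w\<close>.\<close>

lemma cnt_near_positive:
  assumes "matching h N M" "card M \<le> r" "T \<subseteq> MM" "\<And>M'. M' \<in> T \<Longrightarrow> \<Union>M' \<inter> \<Union>M = {}"
  shows "(1 - 4 * real r * w) * p (card M) * cnt h N {} T \<le> cnt h N M T"
proof -
  have w4: "4 * w \<le> 1" 
    using w_small mult_right_mono[of 1 "real r" w] r_pos w_nonneg by simp
  have "1 - 4 * real r * w \<le> 1 - real (card M) * (4 * w)"
    using mult_right_mono[of "real (card M)" "real r" "4 * w"] assms(2) w_nonneg by simp
  also have "\<dots> \<le> (1 - 4 * w) ^ card M"
    using Bernoulli_inequality[of "- (4 * w)" "card M"] w4 by simp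
  finally have "(1 - 4 * real r * w) * p (card M) * cnt h N {} T
      \<le> (1 - 4 * w) ^ card M * p (card M) * cnt h N {} T"
    using p_pos[OF assms(2)] cnt_nonneg by (intro mult_right_mono) auto
  also have "\<dots> \<le> cnt h N M T"
    by (rule cnt_near_positive_power[OF matching_finite]) (use assms in auto)
  finally show ?thesis .
qed

text \<open>Pass to the members \<open>J\<close> that are vertex-disjoint from \<open>M\<close>,
  where \<open>cnt_near_positive\<close> applies, then restore the others. A restored member that
  fits into a perfect matching with \<open>M\<close> shares an edge with it, so its remainder is a
  residual set; a conflicting member never fits.\<close>

lemma cnt_family_ge:
  assumes T: "T \<subseteq> MM" and M: "M \<in> MM" "M \<notin> T"
    and res: "(\<Sum>X\<in>residual h N MM M. p (card X)) \<le> \<delta>" and \<delta>: "\<delta> \<le> 1 / 4"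
  shows "(1 - (4 * real r * w + 4 * \<delta>)) * p (card M) * cnt h N {} T \<le> cnt h N M T"
proof -
  define J where "J = {M' \<in> T. \<Union>M' \<inter> \<Union>M = {}}"
  let ?R = "residual h N MM M"
  have mM: "matching h N M" using matching M by simp
  have "?R \<subseteq> (\<lambda>M'. M' - M) ` MM" by (auto simp: residual_def)
  then have finR: "finite ?R" using finite_family finite_surj by metis
  have X: "matching h N (M \<union> X)" "card X \<le> r" "M \<inter> X = {}" if XR: "X \<in> ?R" for X
  proof -
    obtain M' where M': "X = M' - M" "M' \<in> MM" "\<not> conflict h N M M'"
      using XR by (auto simp: residual_def)
    have "M \<union> X = M \<union> M'" using M' by auto
    then show "matching h N (M \<union> X)" using M' by (simp add: conflict_def)
    have "card X \<le> card M'" using M' matching_finite[OF matching] by (intro card_mono) auto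
    then show "card X \<le> r" using card_le[OF M'(2)] by simp
    show "M \<inter> X = {}" using M' by auto
  qed
  have d0: "0 \<le> \<delta>" 
    by (rule order_trans[OF sum_nonneg res]) (use p_pos X in \<open>auto intro: less_imp_le\<close>)
  \<comment> \<open>The union runs over residual sets, so members with the same remainder outside
    \<open>M\<close> are charged once, matching the sum bounded by \<open>\<delta>\<close>.\<close>
  have "cnt h N M J \<le> cnt h N M T + (\<Sum>X\<in>?R. cnt h N (M \<union> X) J)"
  proof (rule cnt_union_bound[OF finR])
    fix F M' assume F: "F \<in> perfect_matchings h N" "M \<subseteq> F" "\<forall>M\<in>J. \<not> M \<subseteq> F" "M' \<in> T" "M' \<subseteq> F"
    have mF: "matching h N F" using F by (simp add: perfect_matchings_def)
    have "M' \<notin> J" using F by auto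
    then obtain e f x where ef: "e \<in> M" "f \<in> M'" "x \<in> e" "x \<in> f"
      using F(4) by (auto simp: J_def)
    then have "e = f" using matching_edge_unique[OF mF] F by blast
    then have "M' \<inter> M \<noteq> {}" using ef by blast
    moreover have "\<not> conflict h N M M'"
      using matching_subset[OF mF, of "M \<union> M'"] F by (simp add: conflict_def)
    \<comment> \<open>Here \<open>M \<notin> T\<close> supplies the condition that \<open>M'\<close>
      differs from \<open>M\<close>.\<close>
    ultimately have "M' - M \<in> ?R" using F(4) T M unfolding residual_def by blast
    then show "\<exists>X\<in>?R. X \<subseteq> F" using F(5) by blast
  qed
  also have "(\<Sum>X\<in>?R. cnt h N (M \<union> X) J) \<le> (\<Sum>X\<in>?R. 4 * p (card X) * cnt h N M J)"
    by (intro sum_mono cnt_local_crude) (use T M card_le X in \<open>auto simp: J_def\<close>)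
  also have "\<dots> = 4 * (\<Sum>X\<in>?R. p (card X)) * cnt h N M J"
    by (simp add: sum_distrib_left sum_distrib_right)
  also have "\<dots> \<le> 4 * \<delta> * cnt h N M J"
    by (intro mult_right_mono mult_left_mono res cnt_nonneg) auto
  finally have 1: "(1 - 4 * \<delta>) * cnt h N M J \<le> cnt h N M T" by (simp add: algebra_simps)
  have 2: "(1 - 4 * real r * w) * p (card M) * cnt h N {} J \<le> cnt h N M J"
    by (rule cnt_near_positive) (use mM T M card_le in \<open>auto simp: J_def\<close>)
  have b: "0 \<le> 1 - 4 * real r * w" using w_small by simp
  have pp: "0 \<le> p (card M)" using p_pos[OF card_le[OF M(1)]] by simp
  \<comment> \<open>Dropping constraints can only enlarge the count, which is the direction needed
    to return from \<open>J\<close> to \<open>T\<close>.\<close>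
  have 3: "cnt h N {} T \<le> cnt h N {} J" by (rule cnt_mono) (auto simp: J_def)
  have "0 \<le> 4 * real r * w * (4 * \<delta>)" using w_nonneg d0 by simp
  then have "1 - (4 * real r * w + 4 * \<delta>) \<le> (1 - 4 * \<delta>) * (1 - 4 * real r * w)"
    by (simp add: algebra_simps)
  then have "(1 - (4 * real r * w + 4 * \<delta>)) * (p (card M) * cnt h N {} T)
     \<le> (1 - 4 * \<delta>) * (1 - 4 * real r * w) * (p (card M) * cnt h N {} T)"
    using pp cnt_nonneg by (intro mult_right_mono) auto
  also have "\<dots> \<le> (1 - 4 * \<delta>) * ((1 - 4 * real r * w) * p (card M) * cnt h N {} J)"
    using b pp 3 \<delta> by (auto simp: mult.assoc intro!: mult_left_mono)
  also have "\<dots> \<le> (1 - 4 * \<delta>) * cnt h N M J" using 2 \<delta> by (intro mult_left_mono) auto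
  finally show ?thesis using 1 by (simp add: mult.assoc)
qed

lemma cnt_family_le:
  assumes T: "T \<subseteq> MM" and M: "M \<in> MM"
  shows "cnt h N M T \<le> (1 + 16 * real r * w) * p (card M) * cnt h N {} T"
proof -
  let ?x = "8 * real r * w"
  have x: "0 \<le> ?x" "?x \<le> 1 / 2" using w_small w_nonneg by auto
  have main: "(1 - ?x) * cnt h N M T \<le> p (card M) * cnt h N {} T"
    using cnt_local[of T "{}" M] T M card_le matching by (simp add: ext_wt_0)
  \<comment> \<open>This is \<open>1/(1 - x) \<le> 1 + 2x\<close> for \<open>x\<close> in
    \<open>[0, 1/2]\<close>, cleared of denominators.\<close>
  have "0 \<le> ?x * (1 - 2 * ?x)" by (rule mult_nonneg_nonneg) (use x in linarith)+
  then have "1 \<le> (1 + 2 * ?x) * (1 - ?x)" by (simp add: algebra_simps)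
  then have "1 * cnt h N M T \<le> (1 + 2 * ?x) * (1 - ?x) * cnt h N M T"
    by (rule mult_right_mono[OF _ cnt_nonneg])
  also have "\<dots> \<le> (1 + 2 * ?x) * (p (card M) * cnt h N {} T)"
    unfolding mult.assoc[of "1 + 2 * ?x"] using main x by (intro mult_left_mono) auto
  finally show ?thesis by (simp add: mult.assoc)
qed

section \<open>Multiplying the conditional factors\<close>

text \<open>Reveal the members one at a time and bound each factor by
  \<open>1 - y \<le> exp (- y)\<close>.\<close>

lemma cnt_avoid_le:
  assumes res: "\<And>M. M \<in> MM \<Longrightarrow> (\<Sum>X\<in>residual h N MM M. p (card X)) \<le> \<delta>" and \<delta>: "\<delta> \<le> 1 / 4"
    and T: "T \<subseteq> MM"
  shows "cnt h N {} T \<le> exp (- (1 - (4 * real r * w + 4 * \<delta>)) * (\<Sum>M\<in>T. p (card M))) * cnt h N {} {}"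
proof -
  have "finite T" using T finite_family finite_subset by blast
  then show ?thesis using T
  proof (induction T rule: finite_induct)
    case (insert M T)
    let ?a = "1 - (4 * real r * w + 4 * \<delta>)"
    have "?a * p (card M) * cnt h N {} T \<le> cnt h N M T"
      by (rule cnt_family_ge) (use insert res \<delta> in auto)
    then have "cnt h N {} (insert M T) \<le> (1 - ?a * p (card M)) * cnt h N {} T"
      by (simp add: cnt_insert algebra_simps)
    also have "\<dots> \<le> exp (- ?a * p (card M)) * cnt h N {} T"
      using exp_ge_add_one_self[of "- ?a * p (card M)"] by (intro mult_right_mono cnt_nonneg) (simp only: mult_minus_left minus_mult_left[symmetric] diff_conv_add_uminus)
    also have "\<dots> \<le> exp (- ?a * p (card M)) * (exp (- ?a * (\<Sum>M\<in>T. p (card M))) * cnt h N {} {})"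
      using insert by (intro mult_left_mono) auto
    also have "\<dots> = exp (- ?a * (\<Sum>M\<in>insert M T. p (card M))) * cnt h N {} {}"
      by (simp only: sum.insert[OF insert.hyps] distrib_left exp_add mult.assoc)
    finally show ?case .
  qed simp
qed

text \<open>The converse bound uses \<open>ln (1 - y) \<ge> - y - 2y^2\<close> for \<open>y\<close>
  up to 1/2; the quadratic term is harmless because a single member weighs at most
  \<open>w\<close>.\<close>

lemma cnt_avoid_ge:
  assumes T: "T \<subseteq> MM"
  shows "exp (- (1 + 24 * real r * w) * (\<Sum>M\<in>T. p (card M))) * cnt h N {} {} \<le> cnt h N {} T"
proof -
  have "finite T" using T finite_family finite_subset by blast
  then show ?thesis using T
  proof (induction T rule: finite_induct)
    case (insert M T)
    let ?a = "1 + 16 * real r * w" and ?c = "1 + 24 * real r * w"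
    let ?y = "p (card M)"
    have M: "M \<in> MM" using insert by simp
    have y0: "0 < ?y" using p_pos[OF card_le[OF M]] .
    obtain e where "e \<in> M" using nonempty[OF M] by blast
    then have "e \<noteq> {}" using matching[OF M] edge_nonempty unfolding matching_def by blast
    then obtain x where "x \<in> \<Union>M" using \<open>e \<in> M\<close> by blast
    then have yw: "?y \<le> w" using sum_p_meeting_le[of "{x}" "{M}"] M by auto
    have rw: "w \<le> real r * w" using mult_right_mono[of 1 "real r" w] r_pos w_nonneg by simp
    have a: "1 \<le> ?a" "?a \<le> 2" using w_small w_nonneg by auto
    have ay: "?a * ?y \<le> 2 * w" using a yw y0 by (intro mult_mono) auto
    then have half: "?a * ?y \<le> 1 / 2" using rw w_small by simp
    have "2 * (?a * ?y)\<^sup>2 = 2 * (?a * ?y) * (?a * ?y)" by (simp add: power2_eq_square)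
    also have "\<dots> \<le> 2 * (2 * w) * (2 * ?y)"
      by (intro mult_mono mult_left_mono ay mult_right_mono) (use a y0 w_nonneg in auto)
    also have "\<dots> \<le> 8 * (real r * w) * ?y" using mult_right_mono[OF rw less_imp_le[OF y0]] by simp
    \<comment> \<open>The constant is \<open>24 = 16 + 8\<close>: 16 from
      \<open>cnt_family_le\<close> and 8 from the quadratic term.\<close>
    finally have sq: "- ?c * ?y \<le> - (?a * ?y) - 2 * (?a * ?y)\<^sup>2" by (simp add: algebra_simps)
    also have "\<dots> \<le> ln (1 - ?a * ?y)"
      by (rule ln_one_minus_pos_lower_bound) (use a y0 half in auto)
    finally have "exp (- ?c * ?y) \<le> exp (ln (1 - ?a * ?y))" by simp
    also have "\<dots> = 1 - ?a * ?y" using half by simp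
    finally have e: "exp (- ?c * ?y) \<le> 1 - ?a * ?y" .
    have "exp (- ?c * (\<Sum>M\<in>insert M T. p (card M))) * cnt h N {} {}
       = exp (- ?c * ?y) * (exp (- ?c * (\<Sum>M\<in>T. p (card M))) * cnt h N {} {})"
      by (simp only: sum.insert[OF insert.hyps] distrib_left exp_add mult.assoc)
    also have "\<dots> \<le> exp (- ?c * ?y) * cnt h N {} T"
      using insert by (intro mult_left_mono) auto
    also have "\<dots> \<le> (1 - ?a * ?y) * cnt h N {} T" by (rule mult_right_mono[OF e cnt_nonneg])
    also have "\<dots> \<le> cnt h N {} (insert M T)"
      using cnt_family_le[of T M] insert by (simp add: cnt_insert algebra_simps)
    finally show ?case .
  qed simp
qed

end

subsection \<open>Probabilities and asymptotics\<close>

lemma prob_pm_card: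
  assumes "perfect_matchings h N \<noteq> {}"
  shows "prob_pm h N A = real (card (perfect_matchings h N \<inter> A)) / real (card (perfect_matchings h N))"
  unfolding prob_pm_def by (rule measure_pmf_of_set[OF assms finite_perfect_matchings])

text \<open>With nothing forbidden and vertex weight 0, the upper and lower switching bounds
  coincide and give the exact value.\<close>

lemma prob_ext_event:
  assumes even: "h = Complete \<Longrightarrow> even N" and M: "matching h N M"
    and r: "card M \<le> r" "1 \<le> r" "8 * r\<^sup>2 \<le> N"
  shows "prob_pm h N (ext_event h N M) = pr_ext h (real N) (card M)"
proof -
  interpret E: light_family h N "{}" r 0
    by unfold_locales (use even r in auto)
  have ne: "perfect_matchings h N \<noteq> {}" using even by (rule perfect_matchings_nonempty)
  have "cnt h N M {} \<le> pr_ext h (real N) (card M) * cnt h N {} {}"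
    using cnt_matching_le[OF matching_finite[OF M], of h N "{}" "{}"] M r E.r_linear
    by (simp add: ext_wt_0)
  moreover have "pr_ext h (real N) (card M) * cnt h N {} {} \<le> cnt h N M {}"
    using E.cnt_near_positive[OF M r(1), of "{}"] by simp
  ultimately have eq: "cnt h N M {} = pr_ext h (real N) (card M) * cnt h N {} {}" by simp
  have "perfect_matchings h N \<inter> ext_event h N M = {F \<in> perfect_matchings h N. M \<subseteq> F}"
    by (auto simp: ext_event_def)
  then have "prob_pm h N (ext_event h N M) = cnt h N M {} / cnt h N {} {}"
    by (simp add: prob_pm_card[OF ne] cnt_def)
  also have "cnt h N {} {} > 0"
    using ne finite_perfect_matchings by (simp add: cnt_def card_gt_0_iff)
  then have "cnt h N M {} / cnt h N {} {} = pr_ext h (real N) (card M)"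
    unfolding eq by simp
  finally show ?thesis .
qed

lemma prob_avoid_cnt:
  assumes "perfect_matchings h N \<noteq> {}"
  shows "prob_pm h N (\<Inter>M\<in>MM. - ext_event h N M) = cnt h N {} MM / cnt h N {} {}"
proof -
  have "perfect_matchings h N \<inter> (\<Inter>M\<in>MM. - ext_event h N M)
      = {F \<in> perfect_matchings h N. \<forall>M\<in>MM. \<not> M \<subseteq> F}"
    by (auto simp: ext_event_def)
  then show ?thesis by (simp add: prob_pm_card[OF assms] cnt_def)
qed

lemma max_size_ge:
  assumes "finite MM" "M \<in> MM" shows "card M \<le> max_size MM"
  unfolding max_size_def using assms by simp

lemma max_size_pos:
  assumes MM: "\<And>M. M \<in> MM \<Longrightarrow> matching h N M \<and> M \<noteq> {}" and "MM \<noteq> {}"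
  shows "1 \<le> max_size MM"
proof -
  obtain M where M: "M \<in> MM" using assms(2) by blast
  have fin: "finite MM" using MM by (blast intro: finite_matching_family)
  have "finite M" using MM[OF M] matching_finite by blast
  then have "1 \<le> card M" using MM[OF M] by (simp add: Suc_le_eq card_gt_0_iff)
  then show ?thesis using max_size_ge[OF fin M] by simp
qed

text \<open>By regularity every vertex carries the same weight \<open>W\<close>. Double counting
  incidences of vertices and matchings gives \<open>|V| * W\<close> at most \<open>2r\<close> times
  the total weight.\<close>

lemma regular_weight_le:
  assumes MM: "\<And>M. M \<in> MM \<Longrightarrow> matching h N M" and fin: "finite MM"
    and reg: "regular_collection h N MM d"
    and r: "\<And>M. M \<in> MM \<Longrightarrow> card M \<le> r" and q: "\<And>i. i \<le> r \<Longrightarrow> 0 \<le> q i" and N: "0 < N"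
  shows "(\<Sum>M | M \<in> MM \<and> v \<in> \<Union>M. q (card M)) \<le> 2 * real r * (\<Sum>M\<in>MM. q (card M)) / real N"
proof (cases "v \<in> verts h N")
  case False
  then have "{M. M \<in> MM \<and> v \<in> \<Union>M} = {}" using MM Union_matching_subset by blast
  then have "(\<Sum>M | M \<in> MM \<and> v \<in> \<Union>M. q (card M)) = 0"
    by (simp only: sum.empty)
  also have "0 \<le> 2 * real r * (\<Sum>M\<in>MM. q (card M)) / real N"
    using r q by (intro divide_nonneg_nonneg mult_nonneg_nonneg sum_nonneg) auto
  finally show ?thesis .
next
  case True
  define W where "W = (\<Sum>i\<le>r. real (d i) * q i)"
  have W: "(\<Sum>M | M \<in> MM \<and> u \<in> \<Union>M. q (card M)) = W" if u: "u \<in> verts h N" for u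
  proof -
    have "(\<Sum>M | M \<in> MM \<and> u \<in> \<Union>M. q (card M))
        = (\<Sum>i\<le>r. \<Sum>M\<in>{M \<in> {M. M \<in> MM \<and> u \<in> \<Union>M}. card M = i}. q (card M))"
      by (rule sum.group[symmetric]) (use fin r in auto)
    also have "\<dots> = (\<Sum>i\<le>r. \<Sum>M\<in>{M \<in> of_size MM i. u \<in> \<Union>M}. q i)"
      by (intro sum.cong) (auto simp: of_size_def)
    also have "\<dots> = W"
      unfolding W_def using reg u by (intro sum.cong) (auto simp: regular_collection_def)
    finally show ?thesis .
  qed
  have W0: "0 \<le> W" unfolding W_def using q by (intro sum_nonneg) auto
  \<comment> \<open>The hosts have \<open>N\<close> and \<open>2 * N\<close> vertices;
    \<open>N\<close> is a common lower bound.\<close>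
  have "real N * W \<le> real (card (verts h N)) * W"
    using W0 by (intro mult_right_mono) (cases h, auto)
  also have "\<dots> = (\<Sum>u\<in>verts h N. \<Sum>M | M \<in> MM \<and> u \<in> \<Union>M. q (card M))" using W by simp
  also have "\<dots> = (\<Sum>u\<in>verts h N. \<Sum>M\<in>MM. if u \<in> \<Union>M then q (card M) else 0)"
    by (simp only: sum.inter_filter[OF fin])
  also have "\<dots> = (\<Sum>M\<in>MM. \<Sum>u\<in>verts h N. if u \<in> \<Union>M then q (card M) else 0)"
    by (rule sum.swap)
  also have "\<dots> \<le> (\<Sum>M\<in>MM. 2 * real r * q (card M))"
  proof (rule sum_mono)
    fix M assume M: "M \<in> MM"
    have "(\<Sum>u\<in>verts h N. if u \<in> \<Union>M then q (card M) else 0)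
        = (\<Sum>u | u \<in> verts h N \<and> u \<in> \<Union>M. q (card M))"
      by (simp only: sum.inter_filter[OF finite_verts])
    also have "{u. u \<in> verts h N \<and> u \<in> \<Union>M} = \<Union>M" using Union_matching_subset[OF MM[OF M]] by auto
    also have "(\<Sum>u\<in>\<Union>M. q (card M)) = 2 * real (card M) * q (card M)"
      using card_Union_matching[OF MM[OF M]] by simp
    also have "\<dots> \<le> 2 * real r * q (card M)" using r[OF M] q by (intro mult_right_mono) auto
    finally show "(\<Sum>u\<in>verts h N. if u \<in> \<Union>M then q (card M) else 0) \<le> 2 * real r * q (card M)" .
  qed
  also have "\<dots> = 2 * real r * (\<Sum>M\<in>MM. q (card M))" by (simp add: sum_distrib_left)
  finally have "W \<le> 2 * real r * (\<Sum>M\<in>MM. q (card M)) / real N"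
    using N by (simp add: field_simps)
  then show ?thesis using W[OF True] by simp
qed

text \<open>With \<open>w = 2rm/N\<close>, the condition \<open>16rw \<le> 1\<close> reads
  \<open>32r^2 m \<le> N\<close>, and the error terms \<open>24rwm\<close> and \<open>4rwm\<close>
  become \<open>48r^2 m^2/N\<close> and \<open>8r^2 m^2/N\<close>.\<close>

lemma prob_avoid_bounds:
  fixes h :: host and N :: nat and MM :: "nat set set set"
  defines "r \<equiv> real (max_size MM)" and "m \<equiv> mu h N MM"
  assumes even: "h = Complete \<Longrightarrow> even N"
    and MM: "\<And>M. M \<in> MM \<Longrightarrow> matching h N M \<and> M \<noteq> {}" "MM \<noteq> {}"
    and reg: "regular_collection h N MM d"
    and small: "8 * r\<^sup>2 \<le> real N" "32 * r\<^sup>2 * m \<le> real N"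
    and res: "\<And>M. M \<in> MM \<Longrightarrow> (\<Sum>X\<in>residual h N MM M. pr_ext h (real N) (card X)) \<le> \<delta>"
    and \<delta>: "\<delta> \<le> 1 / 4"
  shows "exp (- m - 48 * r\<^sup>2 * m\<^sup>2 / real N) \<le> prob_pm h N (\<Inter>M\<in>MM. - ext_event h N M)"
    and "prob_pm h N (\<Inter>M\<in>MM. - ext_event h N M) \<le> exp (- m + 8 * r\<^sup>2 * m\<^sup>2 / real N + 4 * \<delta> * m)"
proof -
  let ?r = "max_size MM" and ?p = "\<lambda>i. pr_ext h (real N) i"
  define w where "w = 2 * r * m / real N"
  have fin: "finite MM" using MM(1) by (blast intro: finite_matching_family)
  have card_le: "card M \<le> ?r" if "M \<in> MM" for M using max_size_ge[OF fin that] .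
  have r1: "1 \<le> ?r" using MM by (rule max_size_pos)
  have "real (8 * ?r\<^sup>2) \<le> real N" using small(1) by (simp add: r_def)
  then have r2: "8 * ?r\<^sup>2 \<le> N" by (simp only: of_nat_le_iff)
  then have N: "0 < N" using r1 by (auto intro: Nat.gr0I)
  \<comment> \<open>The empty family already gives positivity of the weights, which is needed to
    verify \<open>weight\<close> for \<open>MM\<close> itself.\<close>
  interpret E: light_family h N "{}" ?r 0
    by unfold_locales (use even r1 r2 in auto)
  have m: "m = (\<Sum>M\<in>MM. ?p (card M))"
    unfolding m_def mu_def using prob_ext_event[OF even _ card_le r1 r2] MM(1)
    by (intro sum.cong) auto
  interpret light_family h N MM ?r w
  proof
    show "(\<Sum>M | M \<in> MM \<and> v \<in> \<Union>M. ?p (card M)) \<le> w" for v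
      unfolding w_def m r_def
      by (rule regular_weight_le[OF _ fin reg card_le _ N]) (use MM(1) E.p_pos in \<open>auto intro: less_imp_le\<close>)
    show "16 * real ?r * w \<le> 1"
      using small(2) N by (simp add: w_def r_def field_simps power2_eq_square)
  qed (use even MM(1) card_le r1 r2 in auto)
  have ne: "perfect_matchings h N \<noteq> {}" using even by (rule perfect_matchings_nonempty)
  have pos: "cnt h N {} {} > 0"
    using ne finite_perfect_matchings by (simp add: cnt_def card_gt_0_iff)
  have "exp (- (1 + 24 * real ?r * w) * m) * cnt h N {} {} \<le> cnt h N {} MM"
    unfolding m by (rule cnt_avoid_ge) simp
  moreover have "- (1 + 24 * real ?r * w) * m = - m - 48 * r\<^sup>2 * m\<^sup>2 / real N"
    by (simp add: w_def r_def field_simps power2_eq_square)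
  ultimately show "exp (- m - 48 * r\<^sup>2 * m\<^sup>2 / real N) \<le> prob_pm h N (\<Inter>M\<in>MM. - ext_event h N M)"
    using pos by (simp add: prob_avoid_cnt[OF ne] pos_le_divide_eq)
  have "cnt h N {} MM \<le> exp (- (1 - (4 * real ?r * w + 4 * \<delta>)) * m) * cnt h N {} {}"
    unfolding m by (rule cnt_avoid_le) (use res \<delta> in auto)
  moreover have "- (1 - (4 * real ?r * w + 4 * \<delta>)) * m = - m + 8 * r\<^sup>2 * m\<^sup>2 / real N + 4 * \<delta> * m"
    using N by (simp add: w_def r_def field_simps power2_eq_square)
  ultimately show "prob_pm h N (\<Inter>M\<in>MM. - ext_event h N M) \<le> exp (- m + 8 * r\<^sup>2 * m\<^sup>2 / real N + 4 * \<delta> * m)"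
    using pos by (simp add: prob_avoid_cnt[OF ne] pos_divide_le_eq)
qed

theorem theorem4:
  fixes h :: "nat \<Rightarrow> host"
    and N :: "nat \<Rightarrow> nat"
    and MM :: "nat \<Rightarrow> nat set set set"
    and d :: "nat \<Rightarrow> nat \<Rightarrow> nat"
    and \<delta> :: "nat \<Rightarrow> real"
    and c :: real
  assumes "filterlim N at_top sequentially"
    and "\<And>n. h n = Complete \<Longrightarrow> even (N n)"
    and "\<And>n M. M \<in> MM n \<Longrightarrow> matching (h n) (N n) M \<and> M \<noteq> {}"
    and "\<And>n. regular_collection (h n) (N n) (MM n) (d n)"
    and "(\<lambda>n. mu (h n) (N n) (MM n)) \<in>
           o[sequentially](\<lambda>n. sqrt (real (N n)) * real (max_size (MM n)) powr (- 3 / 2))"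
    and "c > 0" and "\<And>n. mu (h n) (N n) (MM n) \<ge> c"
    and "\<And>n. delta_sparse (h n) (N n) (MM n) (d n) (\<delta> n)"
    and "\<delta> \<in> o[sequentially](\<lambda>n. inverse (mu (h n) (N n) (MM n)))"
  shows "(\<lambda>n. prob_pm (h n) (N n) (\<Inter>M\<in>MM n. - ext_event (h n) (N n) M))
           \<sim>[sequentially] (\<lambda>n. exp (- mu (h n) (N n) (MM n)))"
proof -
  define m where "m n = mu (h n) (N n) (MM n)" for n
  define r where "r n = real (max_size (MM n))" for n
  define P where "P n = prob_pm (h n) (N n) (\<Inter>M\<in>MM n. - ext_event (h n) (N n) M)" for n
  \<comment> \<open>Squaring the ratio from the growth hypothesis gives \<open>m^2 r^3/N\<close>,
    which dominates the actual error \<open>t\<close> since \<open>r\<close> is at least 1.\<close>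
  define f where "f n = (m n / (sqrt (real (N n)) * r n powr (- 3 / 2)))\<^sup>2" for n
  define t where "t n = (r n)\<^sup>2 * (m n)\<^sup>2 / real (N n)" for n
  have mc: "c \<le> m n" for n using assms(7) by (simp add: m_def)
  have m0: "0 < m n" for n using mc[of n] assms(6) by simp
  have ne: "MM n \<noteq> {}" for n
  proof
    assume "MM n = {}"
    then show False using m0[of n] by (simp add: m_def mu_def)
  qed
  have r1: "1 \<le> r n" for n
    using max_size_pos[OF assms(3) ne, of n] by (simp add: r_def)
  have "(\<lambda>n. m n / (sqrt (real (N n)) * r n powr (- 3 / 2))) \<longlonglongrightarrow> 0"
    using smalloD_tendsto[OF assms(5)] by (simp add: m_def r_def)
  from tendsto_power[OF this, of 2] have f0: "f \<longlonglongrightarrow> 0" by (simp add: f_def[abs_def])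
  have Npos: "eventually (\<lambda>n. 0 < N n) sequentially"
    using assms(1) eventually_gt_at_top[of 0] by (simp add: filterlim_iff)
  have f_eq: "f n = (m n)\<^sup>2 * (r n) ^ 3 / real (N n)" for n
  proof -
    have "(r n powr (- 3 / 2))\<^sup>2 = r n powr (- 3)"
      using r1[of n] by (simp add: power2_eq_square powr_add[symmetric])
    also have "\<dots> = inverse (r n ^ 3)"
      using r1[of n] by (simp add: powr_minus)
    finally show ?thesis by (simp add: f_def power_divide power_mult_distrib field_simps)
  qed
  have tf: "t n \<le> f n" for n
  proof -
    have "(r n)\<^sup>2 \<le> (r n) ^ 3" by (rule power_increasing) (use r1 in auto)
    then have "(r n)\<^sup>2 * (m n)\<^sup>2 \<le> (r n) ^ 3 * (m n)\<^sup>2" by (intro mult_right_mono) auto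
    then show ?thesis unfolding t_def f_eq by (intro divide_right_mono) (auto simp: mult.commute)
  qed
  have t0: "t \<longlonglongrightarrow> 0"
    by (rule tendsto_sandwich[OF _ _ tendsto_const f0]) (use tf in \<open>auto simp: t_def\<close>)
  have s0: "(\<lambda>n. \<delta> n * m n) \<longlonglongrightarrow> 0"
    using smalloD_tendsto[OF assms(9)] by (simp add: m_def divide_inverse)
  have ev: "eventually (\<lambda>n. exp (- 48 * t n) \<le> P n / exp (- m n) \<and>
      P n / exp (- m n) \<le> exp (8 * t n + 4 * (\<delta> n * m n))) sequentially"
  proof -
    \<comment> \<open>The thresholds are chosen so that, with \<open>m\<close> at least
      \<open>c\<close>, they yield \<open>8r^2 \<le> N\<close> and \<open>32r^2 m \<le> N\<close>.
      This is where the lower bound on the mean is used.\<close>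
    have "eventually (\<lambda>n. f n < c\<^sup>2 / 8) sequentially" "eventually (\<lambda>n. t n < c / 32) sequentially"
      using order_tendstoD(2)[OF f0, of "c\<^sup>2 / 8"] order_tendstoD(2)[OF t0, of "c / 32"] assms(6)
      by auto
    with Npos show ?thesis
    proof eventually_elim
      case (elim n)
      have sp: "\<forall>F\<in>MM n. (\<Sum>M\<in>residual (h n) (N n) (MM n) F. pr_ext (h n) (real (N n)) (card M)) \<le> \<delta> n"
        "16 * r n * \<delta> n < 1"
        using assms(8)[of n] by (auto simp: delta_sparse_def r_def)
      have "\<delta> n \<le> 1 / 4"
      proof (rule ccontr)
        assume "\<not> \<delta> n \<le> 1 / 4"
        then have "1 * (1 / 4) \<le> r n * \<delta> n" using r1[of n] by (intro mult_mono) auto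
        then show False using sp(2) by simp
      qed
      have "c\<^sup>2 * (8 * (r n)\<^sup>2) \<le> (m n)\<^sup>2 * (8 * (r n) ^ 3)"
        using mc[of n] assms(6) r1[of n]
        by (intro mult_mono mult_left_mono power_mono power_increasing) auto
      also have "\<dots> = 8 * (f n * real (N n))" using elim by (simp add: f_eq)
      also have "\<dots> \<le> 8 * (c\<^sup>2 / 8 * real (N n))" using elim by (intro mult_left_mono mult_right_mono) auto
      finally have small1: "8 * (r n)\<^sup>2 \<le> real (N n)" using assms(6) by simp
      have "c * (32 * (r n)\<^sup>2 * m n) \<le> m n * (32 * (r n)\<^sup>2 * m n)"
        using mc m0[of n] by (intro mult_right_mono) auto
      also have "\<dots> = 32 * (t n * real (N n))" using elim by (simp add: t_def power2_eq_square)
      also have "\<dots> \<le> 32 * (c / 32 * real (N n))" using elim by (intro mult_left_mono mult_right_mono) auto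
      finally have small2: "32 * (r n)\<^sup>2 * m n \<le> real (N n)" using assms(6) by simp
      note bounds = prob_avoid_bounds[OF assms(2) assms(3) ne assms(4), of n "\<delta> n",
          folded r_def m_def P_def, OF _ _ small1 small2 _ \<open>\<delta> n \<le> 1 / 4\<close>]
      have "exp (- m n - 48 * (r n)\<^sup>2 * (m n)\<^sup>2 / real (N n)) \<le> P n"
        by (rule bounds(1)) (use sp in auto)
      moreover have "P n \<le> exp (- m n + 8 * (r n)\<^sup>2 * (m n)\<^sup>2 / real (N n) + 4 * \<delta> n * m n)"
        by (rule bounds(2)) (use sp in auto)
      ultimately have "exp (- m n) * exp (- 48 * t n) \<le> P n"
        "P n \<le> exp (- m n) * exp (8 * t n + 4 * (\<delta> n * m n))"
        by (simp_all add: t_def exp_add[symmetric] algebra_simps)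
      then show ?case by (simp add: pos_le_divide_eq pos_divide_le_eq mult.commute)
    qed
  qed
  have "(\<lambda>n. P n / exp (- m n)) \<longlonglongrightarrow> 1"
  proof (rule tendsto_sandwich)
    show "eventually (\<lambda>n. exp (- 48 * t n) \<le> P n / exp (- m n)) sequentially"
      using ev by eventually_elim simp
    show "eventually (\<lambda>n. P n / exp (- m n) \<le> exp (8 * t n + 4 * (\<delta> n * m n))) sequentially"
      using ev by eventually_elim simp
    have "(\<lambda>n. exp (- 48 * t n)) \<longlonglongrightarrow> exp (- 48 * 0)" by (intro tendsto_intros t0)
    then show "(\<lambda>n. exp (- 48 * t n)) \<longlonglongrightarrow> 1" by simp
    have "(\<lambda>n. exp (8 * t n + 4 * (\<delta> n * m n))) \<longlonglongrightarrow> exp (8 * 0 + 4 * 0)"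
      by (intro tendsto_intros t0 s0)
    then show "(\<lambda>n. exp (8 * t n + 4 * (\<delta> n * m n))) \<longlonglongrightarrow> 1" by simp
  qed
  then show ?thesis unfolding P_def m_def by (rule asymp_equivI')
qed

end
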